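(* Let $\xi,\xi_1,\xi_2,\ldots$ be independent identically distributed non-negative random variables with common distribution $F$, and let $\tau$ be a random variable with values in $\{0,1,2,\ldots\}$ which is independent of $\{\xi_n\}_{n\ge1}$. Assume that $\xi$ is heavy-tailed and $\mathbf{E}\xi<\infty$. Suppose that, for some $c>\mathbf{E}\xi$, $$\mathbf{P}\{c\tau>x\}=o(\overline F(x))\quad\text{as }x\to\infty.$$ Then $$\liminf_{x\to\infty}\frac{\overline{F^{*\tau}}(x)}{\overline F(x)}=\mathbf{E}\tau .$$
   Context: A random variable $\eta$ (or its distribution) is heavy-tailed if $\mathbf{E}e^{\varepsilon\eta}=\infty$ for all $\varepsilon>0$. For a distribution $H$ on the real line, $\overline H(x)=H((x,\infty))$. It is assumed that $\overline F(x)>0$ for all $x$. Put $S_0=0$, $S_n=\xi_1+\cdots+\xi_n$; $F^{*\tau}$ denotes the distribution of the random sum $S_\tau=\xi_1+\cdots+\xi_\tau$, so $\overline{F^{*\tau}}(x)=\mathbf{P}\{S_\tau>x\}$. *)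

theory Defs
  imports "HOL-Probability.Probability" "HOL-Library.Landau_Symbols"
begin

definition tail :: "real measure \<Rightarrow> real \<Rightarrow> real" where
  "tail H x = measure H {x<..}"

text \<open>The nonnegative integral is used so that an infinite exponential moment is literally
  \<open>\<infinity>\<close>; the Bochner integral would be \<open>0\<close>.\<close>

definition heavy_tailed :: "real measure \<Rightarrow> bool" where
  "heavy_tailed H \<longleftrightarrow> (\<forall>\<epsilon>>0. (\<integral>\<^sup>+ x. ennreal (exp (\<epsilon> * x)) \<partial>H) = \<infinity>)"

text \<open>Independence of two random variables with possibly different value types, in terms of the
  \<open>\<sigma>\<close>-algebras they generate (the library's \<open>indep_var\<close> needs equal value types).\<close>

definition indep_rvs ::
  "'a measure \<Rightarrow> 'b measure \<Rightarrow> ('a \<Rightarrow> 'b) \<Rightarrow> 'c measure \<Rightarrow> ('a \<Rightarrow> 'c) \<Rightarrow> bool" where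
  "indep_rvs M N X L Y \<longleftrightarrow>
     X \<in> measurable M N \<and> Y \<in> measurable M L \<and>
     prob_space.indep_set M (sets (vimage_algebra (space M) X N))
       (sets (vimage_algebra (space M) Y L))"

text \<open>The summands are \<open>\<xi> 1, \<xi> 2, \<dots>\<close>; the value \<open>\<xi> 0\<close> is never used.\<close>

definition partial_sum :: "(nat \<Rightarrow> 'a \<Rightarrow> real) \<Rightarrow> nat \<Rightarrow> 'a \<Rightarrow> real" where
  "partial_sum \<xi> n \<omega> = (\<Sum>i\<in>{1..n}. \<xi> i \<omega>)"

definition random_sum_distr ::
  "'a measure \<Rightarrow> (nat \<Rightarrow> 'a \<Rightarrow> real) \<Rightarrow> ('a \<Rightarrow> nat) \<Rightarrow> real measure" where
  "random_sum_distr M \<xi> \<tau> = distr M borel (\<lambda>\<omega>. partial_sum \<xi> (\<tau> \<omega>) \<omega>)"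

end

theory Submission
  imports Defs
begin

text \<open>The lower bound is Fatou's lemma applied to \<open>P(S\<^sub>n > x) \<ge> P(max (\<xi>\<^sub>1, \<dots>, \<xi>\<^sub>n) > x)\<close>, where the right-hand
  side is asymptotically \<open>n\<close> times the tail of \<open>F\<close>; it also settles the case \<open>E \<tau> = \<infinity>\<close>.

  For the upper bound let \<open>m = E \<tau> < \<infinity>\<close> and suppose that \<open>P(S\<^sub>\<tau> > x) \<ge> r P(\<xi> > x)\<close> for \<open>x \<ge> x\<^sub>0\<close>, with
  \<open>r > m\<close>. Let \<open>G(y) = y exp (\<epsilon> y)\<close>. Fix a large \<open>K\<close>; as \<open>\<xi>\<close> is heavy-tailed, every \<open>\<epsilon> > 0\<close> admits a level
  \<open>t\<close> with \<open>E G(\<xi> \<and> t) = K\<close>, and \<open>t\<close> is large when \<open>\<epsilon>\<close> is small. Integrating the tail inequality against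
  \<open>G'\<close> up to \<open>t\<close> gives \<open>E G(S\<^sub>\<tau> \<and> t) \<ge> r (K - G(x\<^sub>0))\<close>. On the other hand, for \<open>c n \<le> t\<close>,
  \<open>E G(S\<^sub>n \<and> t) \<le> n K (E exp (\<epsilon> (\<xi> \<and> t)))^(n-1) \<le> n K exp (\<epsilon> c n)\<close>, because \<open>c > E \<xi>\<close> and \<open>\<epsilon>\<close> is small, while trivially
  \<open>E G(S\<^sub>n \<and> t) \<le> G(t)\<close> for \<open>c n > t\<close>. Since \<open>P(c\<tau> > x) \<le> \<eta> P(\<xi> > x)\<close> beyond some \<open>x\<^sub>1\<close>, averaging over
  \<open>\<tau>\<close> bounds \<open>E G(S\<^sub>\<tau> \<and> t)\<close> by \<open>K (m exp (\<epsilon> x\<^sub>1) + \<eta> K / c) + \<eta> K\<close>. Choosing \<open>K\<close> large, then \<open>\<eta>\<close> small, and letting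
  \<open>\<epsilon> \<rightarrow> 0\<close> contradicts \<open>r > m\<close>.\<close>

section \<open>Truncated functionals and comparison of tails\<close>

text \<open>Clipping at 0 as well as at a level \<open>t \<ge> 0\<close> keeps values in [0, t] for
  every real argument. Bounds and integrability then hold pointwise, although the summands are
  nonnegative only almost surely.\<close>

definition trunc :: "real \<Rightarrow> real \<Rightarrow> real" where
  "trunc t x = max 0 (min x t)"

text \<open>The function \<open>G\<close> of the overview. Its linear factor makes the value at a
  sum of n terms split into n products, which is how the factor n, and later the mean of the index,
  enters the upper bound.\<close>

definition xexp :: "real \<Rightarrow> real \<Rightarrow> real" where
  "xexp \<epsilon> y = y * exp (\<epsilon> * y)"

lemma measurable_trunc [measurable]: "trunc t \<in> borel_measurable borel"
  unfolding trunc_def by measurable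

lemma measurable_xexp [measurable]: "xexp \<epsilon> \<in> borel_measurable borel"
  unfolding xexp_def by measurable

lemma trunc_bounds: "0 \<le> t \<Longrightarrow> 0 \<le> trunc t x" "0 \<le> t \<Longrightarrow> trunc t x \<le> t"
  by (auto simp: trunc_def)

text \<open>Clipping is subadditive when \<open>t \<ge> 0\<close>. For infinite \<open>A\<close>
  both sums are 0 by convention.\<close>

lemma trunc_sum_le:
  assumes "0 \<le> t"
  shows "trunc t (\<Sum>i\<in>A. f i) \<le> (\<Sum>i\<in>A. trunc t (f i))"
proof -
  have add: "trunc t (x + y) \<le> trunc t x + trunc t y" for x y
    using assms by (auto simp: trunc_def max_def min_def)
  show ?thesis
  proof (induction A rule: infinite_finite_induct)
    case (insert a A)
    then show ?case using add[of "f a" "sum f A"] by simp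
  qed (use assms in \<open>auto simp: trunc_def\<close>)
qed

lemma xexp_mono: "0 \<le> \<epsilon> \<Longrightarrow> 0 \<le> x \<Longrightarrow> x \<le> y \<Longrightarrow> xexp \<epsilon> x \<le> xexp \<epsilon> y"
  unfolding xexp_def by (intro mult_mono) (auto simp: mult_left_mono)

lemma xexp_nonneg: "0 \<le> x \<Longrightarrow> 0 \<le> xexp \<epsilon> x"
  unfolding xexp_def by simp

lemma xexp_trunc_bounds:
  assumes "0 \<le> \<epsilon>" "0 \<le> t"
  shows "0 \<le> xexp \<epsilon> (trunc t x)" "xexp \<epsilon> (trunc t x) \<le> xexp \<epsilon> t"
  using assms by (auto intro!: xexp_nonneg xexp_mono trunc_bounds)

lemma (in finite_measure) integrable_xexp_trunc:
  assumes "0 \<le> \<epsilon>" "0 \<le> t" "X \<in> borel_measurable M"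
  shows "integrable M (\<lambda>x. xexp \<epsilon> (trunc t (X x)))"
  using assms xexp_trunc_bounds[OF assms(1,2)]
  by (intro integrable_const_bound[where B="xexp \<epsilon> t"]) auto

lemma (in finite_measure) integrable_exp_trunc:
  assumes "0 \<le> \<epsilon>" "0 \<le> t" "X \<in> borel_measurable M"
  shows "integrable M (\<lambda>x. exp (\<epsilon> * trunc t (X x)))"
  using assms trunc_bounds[OF assms(2)]
  by (intro integrable_const_bound[where B="exp (\<epsilon> * t)"]) (auto intro!: mult_left_mono)

text \<open>Increments of \<open>g\<close> are written as integrals of its derivative; Tonelli's theorem then
  expresses both sides through the tails.\<close>

lemma nn_integral_increment_eq:
  fixes g g' :: "real \<Rightarrow> real"
  assumes "finite_measure \<mu>" and [measurable_cong]: "sets \<mu> = sets borel" and "a \<le> b"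
    and deriv: "\<And>x. (g has_real_derivative g' x) (at x)"
    and [measurable]: "g' \<in> borel_measurable borel"
    and nonneg: "\<And>x. a \<le> x \<Longrightarrow> 0 \<le> g' x"
  shows "(\<integral>\<^sup>+x. ennreal (g (min (max x a) b) - g a) \<partial>\<mu>)
    = (\<integral>\<^sup>+s. ennreal (g' s) * indicator {a..b} s * emeasure \<mu> {s<..} \<partial>lborel)"
proof -
  interpret finite_measure \<mu> by fact
  interpret pair_sigma_finite lborel \<mu> by unfold_locales
  have "ennreal (g (min (max x a) b) - g a)
    = (\<integral>\<^sup>+s. ennreal (g' s) * indicator {a..b} s * indicator {s<..} x \<partial>lborel)" for x
  proof -
    let ?y = "min (max x a) b"
    have "ennreal (g ?y - g a) = (\<integral>\<^sup>+s. ennreal (g' s) * indicator {a..?y} s \<partial>lborel)"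
      using \<open>a \<le> b\<close> deriv nonneg
      by (intro nn_integral_FTC_Icc[symmetric]) (auto intro: has_field_derivative_at_within)
    also have "\<dots> = (\<integral>\<^sup>+s. ennreal (g' s) * indicator {a..b} s * indicator {s<..} x \<partial>lborel)"
    proof (intro nn_integral_cong_AE)
      \<comment> \<open>The two integrands can differ only at \<open>s = x\<close>, and at
        \<open>s = a\<close> when \<open>x < a\<close>.\<close>
      have "AE s in lborel. s \<noteq> x" "AE s in lborel. s \<noteq> a"
        by (rule AE_lborel_singleton)+
      then show "AE s in lborel. ennreal (g' s) * indicator {a..?y} s
          = ennreal (g' s) * indicator {a..b} s * indicator {s<..} x"
        by eventually_elim (auto simp: indicator_def)
    qed
    finally show ?thesis .
  qed
  then have "(\<integral>\<^sup>+x. ennreal (g (min (max x a) b) - g a) \<partial>\<mu>)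
    = (\<integral>\<^sup>+x. (\<integral>\<^sup>+s. ennreal (g' s) * indicator {a..b} s * indicator {s<..} x \<partial>lborel) \<partial>\<mu>)"
    by simp
  also have "\<dots> = (\<integral>\<^sup>+s. (\<integral>\<^sup>+x. ennreal (g' s) * indicator {a..b} s * indicator {s<..} x \<partial>\<mu>) \<partial>lborel)"
  proof (rule Fubini')
    have "(\<lambda>(s, x). ennreal (g' s) * indicator {a..b} s * (if s < x then 1 else 0))
        \<in> borel_measurable (lborel \<Otimes>\<^sub>M \<mu>)"
      by measurable
    moreover have "(if s < x then 1 else 0) = (indicator {s<..} x :: ennreal)" for s x :: real
      by simp
    ultimately show "(\<lambda>(s, x). ennreal (g' s) * indicator {a..b} s * indicator {s<..} x)
        \<in> borel_measurable (lborel \<Otimes>\<^sub>M \<mu>)"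
      by simp
  qed
  also have "\<dots> = (\<integral>\<^sup>+s. ennreal (g' s) * indicator {a..b} s * emeasure \<mu> {s<..} \<partial>lborel)"
    by (subst nn_integral_cmult) (auto simp: sets_eq_imp_space_eq[OF assms(2)])
  finally show ?thesis .
qed

text \<open>Clamping the argument below at \<open>a\<close> removes all tails left of
  \<open>a\<close> from the integral formula. A tail inequality that holds only from some point on
  can therefore be integrated.\<close>

lemma nn_integral_increment_le:
  fixes g g' :: "real \<Rightarrow> real"
  assumes "finite_measure \<mu>" "sets \<mu> = sets borel" "finite_measure \<nu>" "sets \<nu> = sets borel"
    and "a \<le> b" "0 \<le> r"
    and tails: "\<And>s. a \<le> s \<Longrightarrow> tail \<mu> s \<le> r * tail \<nu> s"
    and g: "\<And>x. (g has_real_derivative g' x) (at x)" "g' \<in> borel_measurable borel"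
      "\<And>x. a \<le> x \<Longrightarrow> 0 \<le> g' x"
  shows "(\<integral>\<^sup>+x. ennreal (g (min (max x a) b) - g a) \<partial>\<mu>)
    \<le> ennreal r * (\<integral>\<^sup>+x. ennreal (g (min (max x a) b) - g a) \<partial>\<nu>)"
proof -
  interpret \<mu>: finite_measure \<mu> by fact
  interpret \<nu>: finite_measure \<nu> by fact
  have tails': "emeasure \<mu> {s<..} \<le> ennreal r * emeasure \<nu> {s<..}" if "a \<le> s" for s
    using ennreal_leI[OF tails[OF that]] \<open>0 \<le> r\<close>
    unfolding tail_def \<mu>.emeasure_eq_measure \<nu>.emeasure_eq_measure by (simp only: ennreal_mult')
  have meas: "(\<lambda>s. emeasure \<nu> {s<..}) \<in> borel_measurable borel"
  proof -
    \<comment> \<open>The tail is antitone, so measurability of monotone functions is applied to its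
      negative. It is needed to pull the constant \<open>r\<close> out of the integral.\<close>
    have "mono (\<lambda>s. - measure \<nu> {s<..})"
    proof (rule monoI)
      fix x y :: real assume "x \<le> y"
      then have "measure \<nu> {y<..} \<le> measure \<nu> {x<..}"
        by (intro \<nu>.finite_measure_mono) (simp_all add: assms(4))
      then show "- measure \<nu> {x<..} \<le> - measure \<nu> {y<..}"
        by simp
    qed
    from borel_measurable_mono[OF this]
    have "(\<lambda>s. - (- measure \<nu> {s<..})) \<in> borel_measurable borel"
      by (rule borel_measurable_uminus)
    then have "(\<lambda>s. measure \<nu> {s<..}) \<in> borel_measurable borel"
      unfolding minus_minus .
    then show ?thesis
      unfolding \<nu>.emeasure_eq_measure by (rule measurable_compose[OF _ measurable_ennreal])
  qed
  note [measurable] = g(2)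
  have "(\<integral>\<^sup>+s. ennreal (g' s) * indicator {a..b} s * emeasure \<mu> {s<..} \<partial>lborel)
    \<le> (\<integral>\<^sup>+s. ennreal r * (ennreal (g' s) * indicator {a..b} s * emeasure \<nu> {s<..}) \<partial>lborel)"
  proof (intro nn_integral_mono)
    fix s
    show "ennreal (g' s) * indicator {a..b} s * emeasure \<mu> {s<..}
      \<le> ennreal r * (ennreal (g' s) * indicator {a..b} s * emeasure \<nu> {s<..})"
      using mult_left_mono[OF tails', of s "ennreal (g' s)"]
      by (cases "s \<in> {a..b}") (auto simp: mult.left_commute)
  qed
  also have "\<dots> = ennreal r * (\<integral>\<^sup>+s. ennreal (g' s) * indicator {a..b} s * emeasure \<nu> {s<..} \<partial>lborel)"
    using meas by (intro nn_integral_cmult) simp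
  finally show ?thesis
    using nn_integral_increment_eq[OF assms(1,2,5) g] nn_integral_increment_eq[OF assms(3,4,5) g]
    by simp
qed

section \<open>Truncation levels and exponential moments\<close>

text \<open>Raising the level changes the value only where \<open>x > s\<close>, and there by at
  most the growth of \<open>xexp \<epsilon>\<close> between the two levels. This gives continuity in
  the level.\<close>

lemma xexp_trunc_mono:
  assumes "0 \<le> \<epsilon>" "0 \<le> s" "s \<le> t"
  shows "xexp \<epsilon> (trunc s x) \<le> xexp \<epsilon> (trunc t x)"
    "xexp \<epsilon> (trunc t x) \<le> xexp \<epsilon> (trunc s x) + (xexp \<epsilon> t - xexp \<epsilon> s)"
proof -
  show "xexp \<epsilon> (trunc s x) \<le> xexp \<epsilon> (trunc t x)"
    using assms by (intro xexp_mono) (auto simp: trunc_def)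
  show "xexp \<epsilon> (trunc t x) \<le> xexp \<epsilon> (trunc s x) + (xexp \<epsilon> t - xexp \<epsilon> s)"
  proof (cases "x \<le> s")
    case True
    then have "trunc t x = trunc s x" using assms by (auto simp: trunc_def)
    then show ?thesis using xexp_mono[of \<epsilon> s t] assms by simp
  next
    case False
    then have "trunc s x = s" using assms by (auto simp: trunc_def)
    then show ?thesis using xexp_trunc_bounds(2)[of \<epsilon> t x] assms by simp
  qed
qed

text \<open>Intermediate value theorem in the level: the expectation vanishes at level 0, depends
  continuously on the level, and exceeds every bound because the exponential moment is
  infinite.\<close>

lemma (in real_distribution) exists_truncation_level:
  assumes "heavy_tailed M" "0 < \<epsilon>" "0 \<le> K"
  obtains t where "0 \<le> t" "expectation (\<lambda>x. xexp \<epsilon> (trunc t x)) = K"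
proof -
  let ?A = "\<lambda>t. expectation (\<lambda>x. xexp \<epsilon> (trunc t x))"
  have \<epsilon>: "0 \<le> \<epsilon>" using assms by simp
  have int: "integrable M (\<lambda>x. xexp \<epsilon> (trunc t x))" if "0 \<le> t" for t
    using integrable_xexp_trunc[OF \<epsilon> that, of "\<lambda>x. x"] by simp
  have "\<exists>n::nat. K \<le> ?A n"
  proof (rule ccontr)
    assume "\<not> (\<exists>n::nat. K \<le> ?A n)"
    then have less: "?A (real n) < K" for n :: nat by (simp add: not_le)
    \<comment> \<open>If the expectations stayed below \<open>K\<close>, monotone convergence along
      integer levels would make the exponential moment finite.\<close>
    have "(\<integral>\<^sup>+x. ennreal (exp (\<epsilon> * x)) \<partial>M)
      \<le> (\<integral>\<^sup>+x. (SUP n. ennreal (exp \<epsilon> + xexp \<epsilon> (trunc (real n) x))) \<partial>M)"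
    proof (intro nn_integral_mono)
      fix x
      obtain n :: nat where n: "x \<le> real n" using real_arch_simple by blast
      have "exp (\<epsilon> * x) \<le> exp \<epsilon> + xexp \<epsilon> (trunc (real n) x)"
      \<comment> \<open>For \<open>x \<le> 1\<close> the constant \<open>exp \<epsilon>\<close>
        suffices; for \<open>x > 1\<close> the linear factor of \<open>xexp\<close> only
        helps.\<close>
      proof (cases "x \<le> 1")
        case True
        then have "exp (\<epsilon> * x) \<le> exp \<epsilon>"
          using mult_left_mono[of x 1 \<epsilon>] \<epsilon> by (simp only: exp_le_cancel_iff mult_1_right)
        then show ?thesis using xexp_trunc_bounds(1)[OF \<epsilon>, of "real n" x] by linarith
      next
        case False
        then have "trunc (real n) x = x" using n by (simp add: trunc_def)
        moreover have "1 * exp (\<epsilon> * x) \<le> xexp \<epsilon> x"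
          unfolding xexp_def using False by (intro mult_right_mono) auto
        ultimately show ?thesis by (simp add: add_increasing)
      qed
      then show "ennreal (exp (\<epsilon> * x)) \<le> (SUP n. ennreal (exp \<epsilon> + xexp \<epsilon> (trunc (real n) x)))"
        by (intro SUP_upper2[of n] ennreal_leI) auto
    qed
    also have "\<dots> = (SUP n. \<integral>\<^sup>+x. ennreal (exp \<epsilon> + xexp \<epsilon> (trunc (real n) x)) \<partial>M)"
      by (intro nn_integral_monotone_convergence_SUP)
        (auto simp: incseq_def le_fun_def \<epsilon> intro!: ennreal_leI xexp_trunc_mono)
    also have "\<dots> \<le> ennreal (exp \<epsilon> + K)"
    proof (intro SUP_least)
      fix n :: nat
      have "(\<integral>\<^sup>+x. ennreal (exp \<epsilon> + xexp \<epsilon> (trunc (real n) x)) \<partial>M) = ennreal (exp \<epsilon> + ?A n)"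
        using xexp_trunc_bounds(1)[OF \<epsilon>, of "real n"] int[of n] prob_space
        by (subst nn_integral_eq_integral) (auto intro!: add_nonneg_nonneg)
      then show "(\<integral>\<^sup>+x. ennreal (exp \<epsilon> + xexp \<epsilon> (trunc (real n) x)) \<partial>M) \<le> ennreal (exp \<epsilon> + K)"
        using less[of n] by (simp add: ennreal_leI)
    qed
    finally show False
      using assms(1,2) unfolding heavy_tailed_def by (auto simp: top_unique)
  qed
  then obtain n :: nat where n: "K \<le> ?A n" ..
  have Lip: "\<bar>?A s - ?A t\<bar> \<le> \<bar>xexp \<epsilon> s - xexp \<epsilon> t\<bar>" if "0 \<le> s" "0 \<le> t" for s t
  proof -
    have *: "\<bar>?A t - ?A s\<bar> \<le> \<bar>xexp \<epsilon> t - xexp \<epsilon> s\<bar>" if "0 \<le> s" "s \<le> t" for s t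
    proof -
      have "?A s \<le> ?A t"
        using that \<epsilon> by (intro integral_mono int xexp_trunc_mono) auto
      moreover have "?A t \<le> expectation (\<lambda>x. xexp \<epsilon> (trunc s x) + (xexp \<epsilon> t - xexp \<epsilon> s))"
        using that \<epsilon> int by (intro integral_mono xexp_trunc_mono) auto
      moreover have "\<dots> = ?A s + (xexp \<epsilon> t - xexp \<epsilon> s)"
        using that int[of s] prob_space by simp
      ultimately show ?thesis by linarith
    qed
    show ?thesis using *[of s t] *[of t s] that by (cases "s \<le> t") (auto simp: abs_minus_commute)
  qed
  have "continuous_on {0..real n} ?A"
    unfolding continuous_on_iff
  proof (intro ballI allI impI)
    fix s e :: real assume s: "s \<in> {0..real n}" and "0 < e"
    \<comment> \<open>By \<open>Lip\<close> the modulus of continuity of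
      \<open>xexp \<epsilon>\<close> also serves for the expectation.\<close>
    have "continuous_on {0..real n} (xexp \<epsilon>)"
      unfolding xexp_def by (intro continuous_intros)
    then obtain d where d: "0 < d"
      "\<And>t. t \<in> {0..real n} \<Longrightarrow> dist t s < d \<Longrightarrow> dist (xexp \<epsilon> t) (xexp \<epsilon> s) < e"
      using s \<open>0 < e\<close> unfolding continuous_on_iff by metis
    have "dist (?A t) (?A s) < e" if "t \<in> {0..real n}" "dist t s < d" for t
      using d(2)[OF that] Lip[of t s] that s by (simp add: dist_real_def)
    with \<open>0 < d\<close> show "\<exists>d>0. \<forall>t\<in>{0..real n}. dist t s < d \<longrightarrow> dist (?A t) (?A s) < e"
      by blast
  qed
  moreover have "trunc 0 x = 0" for x by (auto simp: trunc_def)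
  then have "?A 0 = 0" by (simp add: xexp_def)
  ultimately obtain t where "0 \<le> t" "?A t = K"
    using IVT'[of ?A 0 K "real n"] n \<open>0 \<le> K\<close> by auto
  then show ?thesis by (rule that)
qed

text \<open>Multiply \<open>1 - y \<le> exp (- y)\<close> by \<open>exp y\<close>.\<close>

lemma exp_minus_one_le: "exp y - 1 \<le> y * exp y" for y :: real
proof -
  have "(1 - y) * exp y \<le> exp (- y) * exp y"
    using exp_ge_add_one_self[of "- y"] by (intro mult_right_mono) auto
  then show ?thesis by (simp add: exp_minus field_simps)
qed

text \<open>The crude bound \<open>e\<^sup>y - 1 \<le> y e\<^sup>y\<close> would only give \<open>K\<close> in place of \<open>c\<close>. It is used only where
  \<open>\<epsilon> x > R\<close>, where it gains a factor \<open>R\<close>; the rest is governed by the mean.\<close>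

lemma (in real_distribution) eventually_exp_moment_le:
  assumes nonneg: "AE x in M. 0 \<le> x" and int: "integrable M (\<lambda>x. x)"
    and c: "expectation (\<lambda>x. x) < c" and "0 < K"
  shows "\<forall>\<^sub>F k in sequentially. \<forall>t\<ge>0.
    expectation (\<lambda>x. xexp (inverse (real (Suc k))) (trunc t x)) \<le> K \<longrightarrow>
    expectation (\<lambda>x. exp (inverse (real (Suc k)) * trunc t x)) \<le> exp (inverse (real (Suc k)) * c)"
proof -
  define a where "a = expectation (\<lambda>x. x)"
  \<comment> \<open>The large values will contribute at most \<open>K / R\<close>, which this choice
    makes half of the gap between \<open>c\<close> and the mean.\<close>
  define R where "R = 2 * K / (c - a)"
  have R: "0 < R" "K / R = (c - a) / 2" using c \<open>0 < K\<close> by (auto simp: R_def a_def)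
  define e where "e k = inverse (real (Suc k))" for k
  have e: "0 < e k" for k by (simp add: e_def)
  have e_lim: "e \<longlonglongrightarrow> 0"
    unfolding e_def by (rule LIMSEQ_inverse_real_of_nat)
  \<comment> \<open>A difference quotient of the exponential at 0 with the exponent capped at
    \<open>R\<close>. The cap gives the integrable majorant \<open>x * exp R\<close>, and the
    pointwise limit is \<open>x\<close>, so dominated convergence recovers the mean.\<close>
  define \<psi> where "\<psi> k x = (exp (min (e k * x) R) - 1) / e k" for k x
  have \<psi>_meas [measurable]: "\<psi> k \<in> borel_measurable borel" for k
    unfolding \<psi>_def by measurable
  have \<psi>_bounds: "0 \<le> \<psi> k x" "\<psi> k x \<le> x * exp R" if "0 \<le> x" for k x
  proof -
    let ?y = "min (e k * x) R"
    have y: "0 \<le> ?y" using that e[of k] R by simp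
    then show "0 \<le> \<psi> k x" using e[of k] by (simp add: \<psi>_def)
    have "exp ?y - 1 \<le> ?y * exp ?y" by (rule exp_minus_one_le)
    also have "\<dots> \<le> (e k * x) * exp R" using y by (intro mult_mono) auto
    finally show "\<psi> k x \<le> x * exp R"
      using e[of k] by (simp add: \<psi>_def field_simps)
  qed
  have \<psi>_int: "integrable M (\<psi> k)" for k
  proof (rule Bochner_Integration.integrable_bound)
    show "integrable M (\<lambda>x. x * exp R)" using int by simp
    show "AE x in M. norm (\<psi> k x) \<le> norm (x * exp R)"
      using nonneg by eventually_elim (use \<psi>_bounds in auto)
  qed simp
  have \<psi>_lim: "(\<lambda>k. \<psi> k x) \<longlonglongrightarrow> x" if "0 \<le> x" for x
  proof (rule tendsto_sandwich)
    have "(\<lambda>k. e k * x) \<longlonglongrightarrow> 0 * x" by (intro tendsto_intros e_lim)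
    then have ev: "\<forall>\<^sub>F k in sequentially. e k * x < R"
      using R by (intro order_tendstoD(2)[where y=0]) auto
    show "\<forall>\<^sub>F k in sequentially. x \<le> \<psi> k x"
      using ev
    proof eventually_elim
      case (elim k)
      then show ?case using exp_ge_add_one_self[of "e k * x"] e[of k]
        by (simp add: \<psi>_def field_simps)
    qed
    show "\<forall>\<^sub>F k in sequentially. \<psi> k x \<le> x * exp (e k * x)"
      using ev
    proof eventually_elim
      case (elim k)
      then show ?case using exp_minus_one_le[of "e k * x"] e[of k]
        by (simp add: \<psi>_def field_simps)
    qed
    have "(\<lambda>k. x * exp (e k * x)) \<longlonglongrightarrow> x * exp (0 * x)"
      by (intro tendsto_intros e_lim)
    then show "(\<lambda>k. x * exp (e k * x)) \<longlonglongrightarrow> x" by simp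
  qed simp
  have "(\<lambda>k. expectation (\<psi> k)) \<longlonglongrightarrow> a"
    unfolding a_def
  proof (rule integral_dominated_convergence)
    show "integrable M (\<lambda>x. x * exp R)" using int by simp
    show "AE x in M. (\<lambda>k. \<psi> k x) \<longlonglongrightarrow> x"
      using nonneg by eventually_elim (rule \<psi>_lim)
    show "AE x in M. norm (\<psi> k x) \<le> x * exp R" for k
      using nonneg by eventually_elim (use \<psi>_bounds in auto)
  qed auto
  \<comment> \<open>The midpoint uses up one half of the gap; the other half is left for
    \<open>K / R\<close>.\<close>
  then have "\<forall>\<^sub>F k in sequentially. expectation (\<psi> k) < (a + c) / 2"
    using c by (intro order_tendstoD(2)) (auto simp: a_def)
  then show ?thesis
    unfolding e_def[symmetric]
  proof (eventually_elim, intro allI impI)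
    fix k :: nat and t :: real
    assume k: "expectation (\<psi> k) < (a + c) / 2" and "0 \<le> t"
      and K: "expectation (\<lambda>x. xexp (e k) (trunc t x)) \<le> K"
    have ek: "0 \<le> e k" using e[of k] by simp
    have i1: "integrable M (\<lambda>x. xexp (e k) (trunc t x))"
      using integrable_xexp_trunc[OF ek \<open>0 \<le> t\<close>, of "\<lambda>x. x"] by simp
    have i2: "integrable M (\<lambda>x. exp (e k * trunc t x))"
      using integrable_exp_trunc[OF ek \<open>0 \<le> t\<close>, of "\<lambda>x. x"] by simp
    have "expectation (\<lambda>x. exp (e k * trunc t x))
      \<le> expectation (\<lambda>x. 1 + e k * (\<psi> k x + xexp (e k) (trunc t x) / R))"
    proof (rule integral_mono_AE[OF i2])
      show "integrable M (\<lambda>x. 1 + e k * (\<psi> k x + xexp (e k) (trunc t x) / R))"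
        using i1 \<psi>_int[of k] by simp
      show "AE x in M. exp (e k * trunc t x) \<le> 1 + e k * (\<psi> k x + xexp (e k) (trunc t x) / R)"
        using nonneg
      proof eventually_elim
        case (elim x)
        let ?y = "trunc t x"
        have y: "0 \<le> ?y" "?y \<le> x" using elim \<open>0 \<le> t\<close> by (auto simp: trunc_def)
        have \<psi>: "e k * \<psi> k x = exp (min (e k * x) R) - 1" using e[of k] by (simp add: \<psi>_def)
        \<comment> \<open>Up to \<open>R\<close> the capped quotient dominates. Beyond it
          \<open>1 \<le> e k * ?y / R\<close>, and multiplying by the exponential produces the
          \<open>xexp\<close> term divided by \<open>R\<close>.\<close>
        show ?case
        proof (cases "e k * ?y \<le> R")
          case True
          moreover have "e k * ?y \<le> e k * x" using y ek by (intro mult_left_mono)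
          ultimately have "exp (e k * ?y) \<le> 1 + e k * \<psi> k x" unfolding \<psi> by simp
          moreover have "0 \<le> e k * (xexp (e k) ?y / R)"
            using xexp_trunc_bounds(1)[OF ek \<open>0 \<le> t\<close>, of x] ek R by simp
          ultimately show ?thesis by (simp add: distrib_left)
        next
          case False
          then have "1 \<le> e k * ?y / R" using R(1) by simp
          then have "1 * exp (e k * ?y) \<le> e k * ?y / R * exp (e k * ?y)"
            by (intro mult_right_mono) auto
          also have "\<dots> = e k * (xexp (e k) ?y / R)" by (simp add: xexp_def)
          finally have "exp (e k * ?y) \<le> e k * (xexp (e k) ?y / R)" by simp
          moreover have "0 \<le> e k * \<psi> k x" using \<psi>_bounds(1)[OF elim, of k] ek by simp
          ultimately show ?thesis by (simp add: distrib_left)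
        qed
      qed
    qed
    also have "\<dots> = 1 + e k * (expectation (\<psi> k) + expectation (\<lambda>x. xexp (e k) (trunc t x)) / R)"
      using i1 \<psi>_int[of k] prob_space by simp
    also have "\<dots> \<le> 1 + e k * c"
    proof -
      have "expectation (\<lambda>x. xexp (e k) (trunc t x)) / R \<le> K / R"
        using K R(1) by (simp add: divide_right_mono)
      then have "expectation (\<psi> k) + expectation (\<lambda>x. xexp (e k) (trunc t x)) / R \<le> c"
        using k R(2) by (simp add: field_simps)
      then show ?thesis using ek by (simp add: mult_left_mono)
    qed
    also have "\<dots> \<le> exp (e k * c)" by (rule exp_ge_add_one_self)
    finally show "expectation (\<lambda>x. exp (e k * trunc t x)) \<le> exp (e k * c)" .
  qed
qed

section \<open>Sums of independent truncated variables and random indices\<close>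

text \<open>Distribute the linear factor over the sum: the i-th term is a product in which index i
  contributes \<open>xexp\<close> and every other index a pure exponential. Independence turns its
  mean into one \<open>K\<close> and n-1 factors \<open>\<phi>\<close>. For empty \<open>I\<close>
  the prefactor 0 makes the truncated exponent harmless.\<close>

lemma (in prob_space)
  assumes indep: "indep_vars (\<lambda>_. borel) X I" and fin: "finite I" and "0 \<le> \<epsilon>" "0 \<le> t"
    and K: "\<And>i. i \<in> I \<Longrightarrow> expectation (\<lambda>\<omega>. xexp \<epsilon> (trunc t (X i \<omega>))) = K"
    and \<phi>: "\<And>i. i \<in> I \<Longrightarrow> expectation (\<lambda>\<omega>. exp (\<epsilon> * trunc t (X i \<omega>))) = \<phi>"
  shows integrable_xexp_sum_trunc: "integrable M (\<lambda>\<omega>. xexp \<epsilon> (\<Sum>i\<in>I. trunc t (X i \<omega>)))"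
    and expectation_xexp_sum_trunc:
      "expectation (\<lambda>\<omega>. xexp \<epsilon> (\<Sum>i\<in>I. trunc t (X i \<omega>))) = real (card I) * (K * \<phi> ^ (card I - 1))"
proof -
  have rv: "X i \<in> borel_measurable M" if "i \<in> I" for i
    using indep that unfolding indep_vars_def by auto
  define f where "f i j y = (if j = i then xexp \<epsilon> (trunc t y) else exp (\<epsilon> * trunc t y))" for i j :: 'b and y
  have f_meas [measurable]: "f i j \<in> borel_measurable borel" for i j
    unfolding f_def by (cases "j = i") simp_all
  have f_indep: "indep_vars (\<lambda>_. borel) (\<lambda>j \<omega>. f i j (X j \<omega>)) I" for i
    using indep by (rule indep_vars_compose2) simp
  have f_int: "integrable M (\<lambda>\<omega>. f i j (X j \<omega>))" if "j \<in> I" for i j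
    using integrable_xexp_trunc[OF \<open>0 \<le> \<epsilon>\<close> \<open>0 \<le> t\<close> rv[OF that]]
      integrable_exp_trunc[OF \<open>0 \<le> \<epsilon>\<close> \<open>0 \<le> t\<close> rv[OF that]]
    by (cases "j = i") (simp_all add: f_def)
  have eq: "xexp \<epsilon> (\<Sum>i\<in>I. trunc t (X i \<omega>)) = (\<Sum>i\<in>I. \<Prod>j\<in>I. f i j (X j \<omega>))" for \<omega>
  proof -
    have "(\<Prod>j\<in>I. f i j (X j \<omega>)) = trunc t (X i \<omega>) * exp (\<epsilon> * (\<Sum>j\<in>I. trunc t (X j \<omega>)))"
      if "i \<in> I" for i
    proof -
      have "(\<Prod>j\<in>I. f i j (X j \<omega>)) = f i i (X i \<omega>) * (\<Prod>j\<in>I - {i}. f i j (X j \<omega>))"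
        using fin that by (rule prod.remove)
      also have "(\<Prod>j\<in>I - {i}. f i j (X j \<omega>)) = (\<Prod>j\<in>I - {i}. exp (\<epsilon> * trunc t (X j \<omega>)))"
        by (intro prod.cong) (auto simp: f_def)
      also have "f i i (X i \<omega>) = trunc t (X i \<omega>) * exp (\<epsilon> * trunc t (X i \<omega>))"
        by (simp add: f_def xexp_def)
      also have "\<dots> * (\<Prod>j\<in>I - {i}. exp (\<epsilon> * trunc t (X j \<omega>)))
          = trunc t (X i \<omega>) * (\<Prod>j\<in>I. exp (\<epsilon> * trunc t (X j \<omega>)))"
        using prod.remove[OF fin that, of "\<lambda>j. exp (\<epsilon> * trunc t (X j \<omega>))"] by simp
      also have "(\<Prod>j\<in>I. exp (\<epsilon> * trunc t (X j \<omega>))) = exp (\<epsilon> * (\<Sum>j\<in>I. trunc t (X j \<omega>)))"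
        using fin by (simp add: exp_sum sum_distrib_left)
      finally show ?thesis .
    qed
    then show ?thesis by (simp add: xexp_def sum_distrib_right)
  qed
  have prod_int: "integrable M (\<lambda>\<omega>. \<Prod>j\<in>I. f i j (X j \<omega>))" for i
    using fin f_indep f_int by (rule indep_vars_integrable)
  then show "integrable M (\<lambda>\<omega>. xexp \<epsilon> (\<Sum>i\<in>I. trunc t (X i \<omega>)))"
    unfolding eq by (intro Bochner_Integration.integrable_sum)
  have "expectation (\<lambda>\<omega>. \<Prod>j\<in>I. f i j (X j \<omega>)) = K * \<phi> ^ (card I - 1)" if "i \<in> I" for i
  proof -
    have "expectation (\<lambda>\<omega>. \<Prod>j\<in>I. f i j (X j \<omega>)) = (\<Prod>j\<in>I. expectation (\<lambda>\<omega>. f i j (X j \<omega>)))"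
      using fin f_indep f_int by (rule indep_vars_lebesgue_integral)
    also have "\<dots> = (\<Prod>j\<in>I. if j = i then K else \<phi>)"
      by (intro prod.cong) (auto simp: f_def K \<phi>)
    also have "\<dots> = K * \<phi> ^ (card I - 1)"
      using fin that by (subst prod.remove[of _ i]) (auto simp: card_Diff_singleton)
    finally show ?thesis .
  qed
  then show "expectation (\<lambda>\<omega>. xexp \<epsilon> (\<Sum>i\<in>I. trunc t (X i \<omega>))) = real (card I) * (K * \<phi> ^ (card I - 1))"
    unfolding eq using prod_int by simp
qed

text \<open>Truncating each summand instead of the sum can only increase the value, so the exact
  formula applies. Enlarging the exponent from n-1 to n costs nothing essential, as
  \<open>exp b \<ge> 1\<close>.\<close>

lemma (in prob_space) expectation_xexp_trunc_sum_le:
  assumes indep: "indep_vars (\<lambda>_. borel) X I" and fin: "finite I" and "0 \<le> \<epsilon>" "0 \<le> t" "0 \<le> b"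
    and K: "\<And>i. i \<in> I \<Longrightarrow> expectation (\<lambda>\<omega>. xexp \<epsilon> (trunc t (X i \<omega>))) = K"
    and \<phi>: "\<And>i. i \<in> I \<Longrightarrow> expectation (\<lambda>\<omega>. exp (\<epsilon> * trunc t (X i \<omega>))) = \<phi>"
    and "0 \<le> K" "\<phi> \<le> exp b"
  shows "expectation (\<lambda>\<omega>. xexp \<epsilon> (trunc t (\<Sum>i\<in>I. X i \<omega>))) \<le> K * (real (card I) * exp (b * real (card I)))"
proof (cases "I = {}")
  case True
  then show ?thesis using \<open>0 \<le> t\<close> by (simp add: xexp_def trunc_def)
next
  case False
  then obtain i where "i \<in> I" by blast
  \<comment> \<open>Only for nonempty \<open>I\<close> is \<open>\<phi>\<close> tied to an
    expectation; nonnegativity makes its powers monotone.\<close>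
  have "0 \<le> \<phi>" unfolding \<phi>[OF \<open>i \<in> I\<close>, symmetric] by (rule Bochner_Integration.integral_nonneg) simp
  have rv: "X i \<in> borel_measurable M" if "i \<in> I" for i
    using indep that unfolding indep_vars_def by auto
  have "expectation (\<lambda>\<omega>. xexp \<epsilon> (trunc t (\<Sum>i\<in>I. X i \<omega>)))
    \<le> expectation (\<lambda>\<omega>. xexp \<epsilon> (\<Sum>i\<in>I. trunc t (X i \<omega>)))"
    using assms rv
    by (intro integral_mono integrable_xexp_trunc integrable_xexp_sum_trunc[OF indep fin]
        xexp_mono trunc_sum_le trunc_bounds borel_measurable_sum) auto
  also have "\<dots> = real (card I) * (K * \<phi> ^ (card I - 1))"
    using assms by (intro expectation_xexp_sum_trunc) auto
  also have "\<dots> \<le> real (card I) * (K * exp (b * real (card I)))"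
  proof -
    have "\<phi> ^ (card I - 1) \<le> exp b ^ (card I - 1)"
      using \<open>0 \<le> \<phi>\<close> \<open>\<phi> \<le> exp b\<close> by (rule power_mono[rotated])
    also have "\<dots> \<le> exp b ^ card I"
      using \<open>0 \<le> b\<close> by (intro power_increasing) auto
    also have "\<dots> = exp (b * real (card I))"
      by (simp add: exp_of_nat_mult[symmetric] mult.commute)
    finally show ?thesis using \<open>0 \<le> K\<close> by (intro mult_left_mono) auto
  qed
  finally show ?thesis by (simp add: mult_ac)
qed

section \<open>Independence of the index and averaging over it\<close>

text \<open>A function of \<open>X\<close> generates a smaller sigma-algebra than \<open>X\<close>,
  and independence passes to smaller families. Mapping both variables into one value type gives
  access to the product rule for expectations.\<close>

lemma (in prob_space) indep_rvs_compose:
  assumes XY: "indep_rvs M N X L Y"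
    and f: "f \<in> measurable N N'" and h: "h \<in> measurable L L'"
  shows "indep_var N' (\<lambda>\<omega>. f (X \<omega>)) L' (\<lambda>\<omega>. h (Y \<omega>))"
proof -
  have X: "X \<in> measurable M N" and Y: "Y \<in> measurable M L"
    and ind: "indep_set (sets (vimage_algebra (space M) X N)) (sets (vimage_algebra (space M) Y L))"
    using XY unfolding indep_rvs_def by auto
  have sub: "sigma_sets (space M) {(\<lambda>\<omega>. g (Z \<omega>)) -` A \<inter> space M |A. A \<in> sets Q'}
      \<subseteq> sets (vimage_algebra (space M) Z Q)"
    if Z: "Z \<in> measurable M Q" and g: "g \<in> measurable Q Q'" for Z Q Q' and g :: "_ \<Rightarrow> 'x"
  proof -
    have "(\<lambda>\<omega>. g (Z \<omega>)) -` A \<inter> space M \<in> sets (vimage_algebra (space M) Z Q)" if "A \<in> sets Q'" for A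
    proof -
      have "(\<lambda>\<omega>. g (Z \<omega>)) -` A \<inter> space M = Z -` (g -` A \<inter> space Q) \<inter> space M"
        using measurable_space[OF Z] by auto
      also have "\<dots> \<in> sets (vimage_algebra (space M) Z Q)"
        using measurable_sets[OF g that] by (rule in_vimage_algebra)
      finally show ?thesis .
    qed
    then have "{(\<lambda>\<omega>. g (Z \<omega>)) -` A \<inter> space M |A. A \<in> sets Q'} \<subseteq> sets (vimage_algebra (space M) Z Q)"
      by blast
    from sets.sigma_sets_subset[OF this] show ?thesis by simp
  qed
  have "indep_set (sigma_sets (space M) {(\<lambda>\<omega>. f (X \<omega>)) -` A \<inter> space M |A. A \<in> sets N'})
     (sigma_sets (space M) {(\<lambda>\<omega>. h (Y \<omega>)) -` A \<inter> space M |A. A \<in> sets L'})"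
    using ind unfolding indep_set_def
    by (rule indep_sets_mono_sets) (auto split: bool.split dest: subsetD[OF sub[OF X f]] subsetD[OF sub[OF Y h]])
  then show ?thesis
    unfolding indep_var_eq using measurable_compose[OF X f] measurable_compose[OF Y h] by auto
qed

lemma (in prob_space) indep_var_nn_integral:
  fixes X Y :: "'a \<Rightarrow> ennreal"
  assumes "indep_var borel X borel Y"
  shows "(\<integral>\<^sup>+\<omega>. X \<omega> * Y \<omega> \<partial>M) = (\<integral>\<^sup>+\<omega>. X \<omega> \<partial>M) * (\<integral>\<^sup>+\<omega>. Y \<omega> \<partial>M)"
proof -
  have "case_bool borel borel = (\<lambda>_. borel :: ennreal measure)"
    by (auto split: bool.split)
  then have "indep_vars (\<lambda>_. borel) (case_bool X Y) UNIV"
    using assms unfolding indep_var_def by simp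
  from indep_vars_nn_integral[OF _ this] show ?thesis
    by (simp add: UNIV_bool mult.commute)
qed

text \<open>At each point the series has a single nonzero term, and nonnegative series may be
  integrated termwise.\<close>

lemma nn_integral_nat_valued:
  fixes \<tau> :: "'a \<Rightarrow> nat" and g :: "nat \<Rightarrow> 'a \<Rightarrow> ennreal"
  assumes [measurable]: "\<tau> \<in> measurable M (count_space UNIV)" "\<And>n. g n \<in> borel_measurable M"
  shows "(\<integral>\<^sup>+\<omega>. g (\<tau> \<omega>) \<omega> \<partial>M) = (\<Sum>n. \<integral>\<^sup>+\<omega>. indicator {n} (\<tau> \<omega>) * g n \<omega> \<partial>M)"
proof -
  have [measurable]: "(\<lambda>\<omega>. indicator {n} (\<tau> \<omega>) :: ennreal) \<in> borel_measurable M" for n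
    by (rule measurable_compose[OF assms(1)]) simp
  have "g (\<tau> \<omega>) \<omega> = (\<Sum>n. indicator {n} (\<tau> \<omega>) * g n \<omega>)" for \<omega>
    by (subst suminf_finite[of "{\<tau> \<omega>}"]) auto
  then have "(\<integral>\<^sup>+\<omega>. g (\<tau> \<omega>) \<omega> \<partial>M) = (\<integral>\<^sup>+\<omega>. (\<Sum>n. indicator {n} (\<tau> \<omega>) * g n \<omega>) \<partial>M)"
    by (intro nn_integral_cong)
  also have "\<dots> = (\<Sum>n. \<integral>\<^sup>+\<omega>. indicator {n} (\<tau> \<omega>) * g n \<omega> \<partial>M)"
    by (intro nn_integral_suminf) measurable
  finally show ?thesis .
qed

lemma (in prob_space) nn_integral_indicator_nat_valued:
  fixes \<tau> :: "'a \<Rightarrow> nat"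
  assumes [measurable]: "\<tau> \<in> measurable M (count_space UNIV)"
  shows "(\<integral>\<^sup>+\<omega>. indicator {n} (\<tau> \<omega>) \<partial>M) = ennreal (prob {\<omega> \<in> space M. \<tau> \<omega> = n})"
proof -
  have "(\<integral>\<^sup>+\<omega>. indicator {n} (\<tau> \<omega>) \<partial>M) = (\<integral>\<^sup>+\<omega>. indicator {\<omega> \<in> space M. \<tau> \<omega> = n} \<omega> \<partial>M)"
    by (intro nn_integral_cong) (auto simp: indicator_def)
  then show ?thesis by (simp add: emeasure_eq_measure)
qed

text \<open>For fixed n the event that the index equals n is independent of the n-th partial sum, so
  each term of the decomposition by index values factors.\<close>

lemma (in prob_space) nn_integral_random_sum:
  fixes \<xi> :: "nat \<Rightarrow> 'a \<Rightarrow> real" and g :: "real \<Rightarrow> ennreal"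
  assumes indep: "indep_rvs M (count_space UNIV) \<tau>
      (\<Pi>\<^sub>M n\<in>{1..}. borel) (\<lambda>\<omega>. \<lambda>n\<in>{1..}. \<xi> n \<omega>)"
    and rv: "\<And>n. 1 \<le> n \<Longrightarrow> \<xi> n \<in> borel_measurable M"
    and [measurable]: "g \<in> borel_measurable borel"
  shows "(\<integral>\<^sup>+\<omega>. g (partial_sum \<xi> (\<tau> \<omega>) \<omega>) \<partial>M)
    = (\<Sum>n. ennreal (prob {\<omega> \<in> space M. \<tau> \<omega> = n}) * (\<integral>\<^sup>+\<omega>. g (partial_sum \<xi> n \<omega>) \<partial>M))"
proof -
  have \<tau> [measurable]: "\<tau> \<in> measurable M (count_space UNIV)"
    using indep unfolding indep_rvs_def by auto
  have [measurable]: "partial_sum \<xi> n \<in> borel_measurable M" for n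
    unfolding partial_sum_def by (intro borel_measurable_sum rv) auto
  have "(\<integral>\<^sup>+\<omega>. indicator {n} (\<tau> \<omega>) * g (partial_sum \<xi> n \<omega>) \<partial>M)
      = ennreal (prob {\<omega> \<in> space M. \<tau> \<omega> = n}) * (\<integral>\<^sup>+\<omega>. g (partial_sum \<xi> n \<omega>) \<partial>M)" for n
  proof -
    \<comment> \<open>The n-th partial sum is read as a measurable function of the whole sequence,
      since independence from the index is stated for that sequence.\<close>
    have comp: "(\<lambda>f. g (\<Sum>i\<in>{1..n}. f i)) \<in> borel_measurable (\<Pi>\<^sub>M i\<in>{1..}. borel)"
      by (intro measurable_compose[OF borel_measurable_sum] measurable_component_singleton) auto
    have "indep_var borel (\<lambda>\<omega>. indicator {n} (\<tau> \<omega>)) borel (\<lambda>\<omega>. g (partial_sum \<xi> n \<omega>))"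
      using indep_rvs_compose[OF indep _ comp, of "indicator {n}" borel]
      by (simp add: partial_sum_def)
    from indep_var_nn_integral[OF this] show ?thesis
      by (simp add: nn_integral_indicator_nat_valued)
  qed
  then show ?thesis
    by (subst nn_integral_nat_valued) simp_all
qed

lemma (in prob_space) nn_integral_nat_valued_eq_suminf:
  fixes \<tau> :: "'a \<Rightarrow> nat"
  assumes [measurable]: "\<tau> \<in> measurable M (count_space UNIV)"
  shows "(\<integral>\<^sup>+\<omega>. f (\<tau> \<omega>) \<partial>M) = (\<Sum>n. ennreal (prob {\<omega> \<in> space M. \<tau> \<omega> = n}) * f n)"
proof -
  have "(\<lambda>\<omega>. indicator {n} (\<tau> \<omega>) :: ennreal) \<in> borel_measurable M" for n
    by (rule measurable_compose[OF assms]) simp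
  then show ?thesis
    by (subst nn_integral_nat_valued)
      (simp_all add: nn_integral_multc nn_integral_indicator_nat_valued assms)
qed

section \<open>Randomly stopped sums\<close>

text \<open>Tail inequalities are available only beyond some point \<open>a\<close>. This function
  is blind to everything below \<open>a\<close>, and differs from the truncated \<open>xexp\<close>
  by at most \<open>xexp \<epsilon> a\<close>.\<close>

definition xexp_increment :: "real \<Rightarrow> real \<Rightarrow> real \<Rightarrow> real \<Rightarrow> real" where
  "xexp_increment \<epsilon> a b x = xexp \<epsilon> (min (max x a) b) - xexp \<epsilon> a"

lemma measurable_xexp_increment [measurable]: "xexp_increment \<epsilon> a b \<in> borel_measurable borel"
  unfolding xexp_increment_def by measurable

lemma xexp_increment_bounds:
  assumes "0 \<le> \<epsilon>" "0 \<le> a" "a \<le> b"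
  shows "0 \<le> xexp_increment \<epsilon> a b x" "xexp_increment \<epsilon> a b x \<le> xexp \<epsilon> (trunc b x)"
    "xexp \<epsilon> (trunc b x) - xexp \<epsilon> a \<le> xexp_increment \<epsilon> a b x"
proof -
  show "0 \<le> xexp_increment \<epsilon> a b x"
    unfolding xexp_increment_def using assms xexp_mono[of \<epsilon> a "min (max x a) b"] by auto
  show "xexp_increment \<epsilon> a b x \<le> xexp \<epsilon> (trunc b x)"
  proof (cases "x \<le> a")
    case True
    then have "xexp_increment \<epsilon> a b x = 0" using assms by (simp add: xexp_increment_def max_def)
    then show ?thesis using xexp_trunc_bounds[of \<epsilon> b x] assms by simp
  next
    case False
    then have "trunc b x = min (max x a) b" using assms by (auto simp: trunc_def)
    then show ?thesis using xexp_nonneg[of a \<epsilon>] assms by (simp add: xexp_increment_def)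
  qed
  show "xexp \<epsilon> (trunc b x) - xexp \<epsilon> a \<le> xexp_increment \<epsilon> a b x"
    unfolding xexp_increment_def using assms
    by (intro diff_right_mono xexp_mono) (auto simp: trunc_def)
qed

lemma nn_integral_xexp_increment_le:
  assumes "finite_measure \<mu>" "sets \<mu> = sets borel" "finite_measure \<nu>" "sets \<nu> = sets borel"
    and "0 \<le> \<epsilon>" "0 \<le> a" "a \<le> b" "0 \<le> r"
    and "\<And>s. a \<le> s \<Longrightarrow> tail \<mu> s \<le> r * tail \<nu> s"
  shows "(\<integral>\<^sup>+x. ennreal (xexp_increment \<epsilon> a b x) \<partial>\<mu>)
    \<le> ennreal r * (\<integral>\<^sup>+x. ennreal (xexp_increment \<epsilon> a b x) \<partial>\<nu>)"
  unfolding xexp_increment_def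
proof (rule nn_integral_increment_le[where g' = "\<lambda>x. (1 + \<epsilon> * x) * exp (\<epsilon> * x)"])
  show "(xexp \<epsilon> has_real_derivative (1 + \<epsilon> * x) * exp (\<epsilon> * x)) (at x)" for x
    unfolding xexp_def by (auto intro!: derivative_eq_intros simp: algebra_simps)
qed (use assms in auto)

locale random_sum = prob_space M for M :: "'a measure" +
  fixes F :: "real measure" and \<xi> :: "nat \<Rightarrow> 'a \<Rightarrow> real" and \<tau> :: "'a \<Rightarrow> nat"
  assumes indep: "indep_vars (\<lambda>_. borel) \<xi> {1..}"
    and distr_\<xi>: "\<And>n. 1 \<le> n \<Longrightarrow> distr M borel (\<xi> n) = F"
    and \<xi>_nonneg: "\<And>n. 1 \<le> n \<Longrightarrow> AE \<omega> in M. 0 \<le> \<xi> n \<omega>"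
    and indep_\<tau>: "indep_rvs M (count_space UNIV) \<tau>
           (\<Pi>\<^sub>M n\<in>{1..}. borel) (\<lambda>\<omega>. \<lambda>n\<in>{1..}. \<xi> n \<omega>)"
begin

lemma rv_\<xi>: "1 \<le> n \<Longrightarrow> \<xi> n \<in> borel_measurable M"
  using indep unfolding indep_vars_def by auto

lemma measurable_\<tau> [measurable]: "\<tau> \<in> measurable M (count_space UNIV)"
  using indep_\<tau> unfolding indep_rvs_def by auto

lemma measurable_partial_sum [measurable]: "partial_sum \<xi> n \<in> borel_measurable M"
  unfolding partial_sum_def by (intro borel_measurable_sum rv_\<xi>) auto

lemma measurable_random_sum [measurable]:
  "(\<lambda>\<omega>. partial_sum \<xi> (\<tau> \<omega>) \<omega>) \<in> borel_measurable M"
  by (rule measurable_compose_countable[OF _ measurable_\<tau>]) simp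

sublocale F: real_distribution F
proof -
  have "prob_space (distr M borel (\<xi> 1))"
    by (intro prob_space_distr rv_\<xi>) simp
  then interpret F: prob_space F by (simp add: distr_\<xi>)
  show "real_distribution F"
    by unfold_locales (simp add: distr_\<xi>[of 1, symmetric])
qed

lemma F_nonneg: "AE x in F. 0 \<le> x"
proof -
  have "AE x in distr M borel (\<xi> 1). 0 \<le> x"
    using \<xi>_nonneg[of 1] by (subst AE_distr_iff) (auto simp: rv_\<xi>)
  then show ?thesis unfolding distr_\<xi>[OF order_refl] .
qed

lemma expectation_\<xi>:
  fixes f :: "real \<Rightarrow> real"
  assumes "1 \<le> n" "f \<in> borel_measurable borel"
  shows "expectation (\<lambda>\<omega>. f (\<xi> n \<omega>)) = (\<integral>x. f x \<partial>F)"
  using assms integral_distr[OF rv_\<xi>[of n], of f] by (simp add: distr_\<xi>)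

lemma tail_eq_cdf: "tail F x = 1 - cdf F x"
proof -
  have "{x<..} = UNIV - {..x}" by auto
  then show ?thesis
    unfolding tail_def cdf_def using F.prob_compl[of "{..x}"] by simp
qed

section \<open>Tail of the random sum and the lower bound\<close>

lemma tail_random_sum_distr:
  "tail (random_sum_distr M \<xi> \<tau>) x = prob {\<omega> \<in> space M. x < partial_sum \<xi> (\<tau> \<omega>) \<omega>}"
  unfolding tail_def random_sum_distr_def
  by (subst measure_distr) (auto intro!: arg_cong[where f=prob])

lemma tail_random_sum_distr_eq_suminf:
  "ennreal (tail (random_sum_distr M \<xi> \<tau>) x)
    = (\<Sum>n. ennreal (prob {\<omega> \<in> space M. \<tau> \<omega> = n} * prob {\<omega> \<in> space M. x < partial_sum \<xi> n \<omega>}))"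
proof -
  have ind: "(\<integral>\<^sup>+\<omega>. indicator {x<..} (f \<omega>) \<partial>M) = ennreal (prob {\<omega> \<in> space M. x < f \<omega>})"
    if [measurable]: "f \<in> borel_measurable M" for f :: "'a \<Rightarrow> real"
  proof -
    have "(\<integral>\<^sup>+\<omega>. indicator {x<..} (f \<omega>) \<partial>M) = (\<integral>\<^sup>+\<omega>. indicator {\<omega> \<in> space M. x < f \<omega>} \<omega> \<partial>M)"
      by (intro nn_integral_cong) (auto simp: indicator_def)
    then show ?thesis by (simp add: emeasure_eq_measure)
  qed
  show ?thesis
    unfolding tail_random_sum_distr using nn_integral_random_sum[OF indep_\<tau> rv_\<xi>, of "indicator {x<..}"]
    by (simp add: ind ennreal_mult')
qed

text \<open>By nonnegativity, a sum at most \<open>x\<close> forces every summand to be at most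
  \<open>x\<close>. Factoring \<open>1 - q ^ n\<close> with \<open>q = cdf F x\<close> leaves the
  tail times a geometric sum, which tends to n as \<open>x\<close> grows.\<close>

lemma tail_partial_sum_ge:
  assumes "0 \<le> x"
  shows "tail F x * (\<Sum>k<n. cdf F x ^ k) \<le> prob {\<omega> \<in> space M. x < partial_sum \<xi> n \<omega>}"
proof -
  have "prob {\<omega> \<in> space M. partial_sum \<xi> n \<omega> \<le> x} \<le> cdf F x ^ n"
  \<comment> \<open>For \<open>n = 0\<close> the intersection used below would be the whole type
    rather than \<open>space M\<close>.\<close>
  proof (cases "n = 0")
    case True
    then show ?thesis using prob_le_1 by simp
  next
    case False
    have ae: "AE \<omega> in M. \<forall>i\<in>{1..n}. 0 \<le> \<xi> i \<omega>"
      using \<xi>_nonneg by (intro AE_finite_allI) auto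
    have "prob {\<omega> \<in> space M. partial_sum \<xi> n \<omega> \<le> x} \<le> prob (\<Inter>i\<in>{1..n}. \<xi> i -` {..x} \<inter> space M)"
    proof (rule finite_measure_mono_AE)
      show "AE \<omega> in M. \<omega> \<in> {\<omega> \<in> space M. partial_sum \<xi> n \<omega> \<le> x} \<longrightarrow>
          \<omega> \<in> (\<Inter>i\<in>{1..n}. \<xi> i -` {..x} \<inter> space M)"
        using ae
      proof eventually_elim
        case (elim \<omega>)
        have "\<xi> i \<omega> \<le> partial_sum \<xi> n \<omega>" if "i \<in> {1..n}" for i
          unfolding partial_sum_def using elim that by (intro member_le_sum) auto
        then show ?case using order_trans by fastforce
      qed
      show "(\<Inter>i\<in>{1..n}. \<xi> i -` {..x} \<inter> space M) \<in> events"
        using False rv_\<xi> by (intro sets.finite_INT) (auto intro: measurable_sets)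
    qed
    also have "\<dots> = (\<Prod>i\<in>{1..n}. prob (\<xi> i -` {..x} \<inter> space M))"
      using False by (intro indep_varsD[OF indep]) auto
    also have "\<dots> = (\<Prod>i\<in>{1..n}. cdf F x)"
    proof (intro prod.cong refl)
      fix i assume "i \<in> {1..n}"
      then have "measure (distr M borel (\<xi> i)) {..x} = prob (\<xi> i -` {..x} \<inter> space M)"
        by (intro measure_distr rv_\<xi>) auto
      with \<open>i \<in> {1..n}\<close> show "prob (\<xi> i -` {..x} \<inter> space M) = cdf F x"
        by (simp add: distr_\<xi> cdf_def)
    qed
    finally show ?thesis by simp
  qed
  moreover have "prob {\<omega> \<in> space M. x < partial_sum \<xi> n \<omega>}
      = 1 - prob {\<omega> \<in> space M. partial_sum \<xi> n \<omega> \<le> x}"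
  proof -
    have "{\<omega> \<in> space M. x < partial_sum \<xi> n \<omega>} = space M - {\<omega> \<in> space M. partial_sum \<xi> n \<omega> \<le> x}"
      by auto
    then show ?thesis by (simp add: prob_compl)
  qed
  ultimately show ?thesis
    unfolding tail_eq_cdf one_diff_power_eq[symmetric] by simp
qed

text \<open>Fatou's lemma by hand: keep finitely many index values, let \<open>x\<close> tend to
  infinity in the finite sum, and only then take the supremum over the cutoff. This also covers an
  infinite mean.\<close>

lemma Liminf_tail_ratio_ge:
  assumes pos: "\<And>x. 0 < tail F x"
  shows "(\<integral>\<^sup>+\<omega>. ennreal (real (\<tau> \<omega>)) \<partial>M)
    \<le> Liminf at_top (\<lambda>x. ennreal (tail (random_sum_distr M \<xi> \<tau>) x / tail F x))"
proof -
  define p where "p n = prob {\<omega> \<in> space M. \<tau> \<omega> = n}" for n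
  have p: "0 \<le> p n" for n by (simp add: p_def)
  have "(\<integral>\<^sup>+\<omega>. ennreal (real (\<tau> \<omega>)) \<partial>M) = (\<Sum>n. ennreal (p n) * ennreal (real n))"
    unfolding p_def by (rule nn_integral_nat_valued_eq_suminf[OF measurable_\<tau>])
  also have "\<dots> = (SUP N. \<Sum>n<N. ennreal (p n) * ennreal (real n))"
    by (rule suminf_eq_SUP)
  also have "\<dots> \<le> Liminf at_top (\<lambda>x. ennreal (tail (random_sum_distr M \<xi> \<tau>) x / tail F x))"
  proof (rule SUP_least)
    fix N
    let ?L = "\<lambda>x. \<Sum>n<N. p n * (\<Sum>k<n. cdf F x ^ k)"
    have "(?L \<longlongrightarrow> (\<Sum>n<N. p n * (\<Sum>k<n. 1 ^ k))) at_top"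
      by (intro tendsto_intros F.cdf_lim_at_top_prob)
    then have "((\<lambda>x. ennreal (?L x)) \<longlongrightarrow> ennreal (\<Sum>n<N. p n * real n)) at_top"
      by (intro tendsto_ennrealI) simp
    then have "ennreal (\<Sum>n<N. p n * real n) = Liminf at_top (\<lambda>x. ennreal (?L x))"
      by (intro lim_imp_Liminf[symmetric]) simp_all
    also have "\<dots> \<le> Liminf at_top (\<lambda>x. ennreal (tail (random_sum_distr M \<xi> \<tau>) x / tail F x))"
    proof (rule Liminf_mono, rule eventually_mono[OF eventually_ge_at_top[of 0]])
      fix x :: real assume "0 \<le> x"
      have "ennreal (tail F x * ?L x) = (\<Sum>n<N. ennreal (p n * (tail F x * (\<Sum>k<n. cdf F x ^ k))))"
        using p pos[of x] by (simp add: sum_distrib_left mult.left_commute sum_nonneg F.cdf_nonneg)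
      also have "\<dots> \<le> (\<Sum>n<N. ennreal (p n * prob {\<omega> \<in> space M. x < partial_sum \<xi> n \<omega>}))"
        using p \<open>0 \<le> x\<close> by (intro sum_mono ennreal_leI mult_left_mono tail_partial_sum_ge) auto
      also have "\<dots> \<le> ennreal (tail (random_sum_distr M \<xi> \<tau>) x)"
        unfolding tail_random_sum_distr_eq_suminf p_def by (intro sum_le_suminf) auto
      finally have "tail F x * ?L x \<le> tail (random_sum_distr M \<xi> \<tau>) x"
        by (subst (asm) ennreal_le_iff) (auto simp: tail_def)
      then show "ennreal (?L x) \<le> ennreal (tail (random_sum_distr M \<xi> \<tau>) x / tail F x)"
        using pos[of x] by (intro ennreal_leI) (simp add: field_simps)
    qed
    finally show "(\<Sum>n<N. ennreal (p n) * ennreal (real n))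
        \<le> Liminf at_top (\<lambda>x. ennreal (tail (random_sum_distr M \<xi> \<tau>) x / tail F x))"
      using p by (simp add: ennreal_mult'[symmetric])
  qed
  finally show ?thesis .
qed

section \<open>Upper bound by comparison of truncated moments\<close>

text \<open>The assumed inequality says that beyond \<open>x0\<close> the tail of \<open>F\<close>
  is at most \<open>1 / r\<close> times that of the random sum. Integrating it against increments
  loses only \<open>xexp \<epsilon> x0\<close> on the left.\<close>

lemma nn_integral_xexp_trunc_random_sum_ge:
  assumes "0 \<le> \<epsilon>" "0 \<le> x0" "x0 \<le> t" "0 < r"
    and tails: "\<And>x. x0 \<le> x \<Longrightarrow> r * tail F x \<le> tail (random_sum_distr M \<xi> \<tau>) x"
    and K: "(\<integral>x. xexp \<epsilon> (trunc t x) \<partial>F) = K"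
  shows "ennreal (r * (K - xexp \<epsilon> x0)) \<le> (\<integral>\<^sup>+\<omega>. ennreal (xexp \<epsilon> (trunc t (partial_sum \<xi> (\<tau> \<omega>) \<omega>))) \<partial>M)"
proof -
  let ?H = "xexp_increment \<epsilon> x0 t" and ?\<mu> = "random_sum_distr M \<xi> \<tau>"
  have "0 \<le> t" using assms by simp
  interpret \<mu>: prob_space ?\<mu>
    unfolding random_sum_distr_def by (rule prob_space_distr) simp
  note H = xexp_increment_bounds[OF assms(1-3)]
  have int: "integrable F (\<lambda>x. xexp \<epsilon> (trunc t x))"
    using F.integrable_xexp_trunc[OF \<open>0 \<le> \<epsilon>\<close> \<open>0 \<le> t\<close>, of "\<lambda>x. x"] by simp
  have intH: "integrable F ?H"
    by (rule Bochner_Integration.integrable_bound[OF int])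
      (use H(1,2) xexp_trunc_bounds[OF \<open>0 \<le> \<epsilon>\<close> \<open>0 \<le> t\<close>] in auto)
  have "K - xexp \<epsilon> x0 = (\<integral>x. xexp \<epsilon> (trunc t x) - xexp \<epsilon> x0 \<partial>F)"
    using int F.prob_space by (simp add: K)
  also have "\<dots> \<le> (\<integral>x. ?H x \<partial>F)"
    using int intH H by (intro integral_mono) auto
  finally have "ennreal (K - xexp \<epsilon> x0) \<le> (\<integral>\<^sup>+x. ennreal (?H x) \<partial>F)"
    using H intH by (subst nn_integral_eq_integral) (auto intro: ennreal_leI)
  also have "\<dots> \<le> ennreal (1 / r) * (\<integral>\<^sup>+x. ennreal (?H x) \<partial>?\<mu>)"
  proof (rule nn_integral_xexp_increment_le)
    show "tail F s \<le> 1 / r * tail ?\<mu> s" if "x0 \<le> s" for s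
      using tails[OF that] \<open>0 < r\<close> by (simp add: field_simps)
  qed (use assms F.finite_measure_axioms \<mu>.finite_measure_axioms in \<open>auto simp: random_sum_distr_def\<close>)
  finally have "ennreal r * ennreal (K - xexp \<epsilon> x0)
      \<le> ennreal r * (ennreal (1 / r) * (\<integral>\<^sup>+x. ennreal (?H x) \<partial>?\<mu>))"
    by (rule mult_left_mono) simp
  also have "\<dots> = (\<integral>\<^sup>+x. ennreal (?H x) \<partial>?\<mu>)"
    using \<open>0 < r\<close> by (simp add: mult.assoc[symmetric] ennreal_mult'[symmetric])
  also have "\<dots> \<le> (\<integral>\<^sup>+x. ennreal (xexp \<epsilon> (trunc t x)) \<partial>?\<mu>)"
    by (intro nn_integral_mono ennreal_leI H)
  also have "\<dots> = (\<integral>\<^sup>+\<omega>. ennreal (xexp \<epsilon> (trunc t (partial_sum \<xi> (\<tau> \<omega>) \<omega>))) \<partial>M)"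
    unfolding random_sum_distr_def by (subst nn_integral_distr) simp_all
  finally show ?thesis using \<open>0 < r\<close> by (simp add: ennreal_mult')
qed


text \<open>Given \<open>\<tau> = n\<close>, the truncated moment is bounded by \<open>D n\<close>.
  The three terms of \<open>D \<tau>\<close> are averaged separately: the linear one gives the mean,
  while the increment at \<open>c * \<tau>\<close> and the overshoot \<open>c * \<tau> > t\<close>
  are small because the tail of \<open>c * \<tau>\<close> is at most \<open>\<eta>\<close> times
  that of \<open>F\<close>.\<close>

lemma nn_integral_xexp_trunc_random_sum_le:
  assumes "0 \<le> \<epsilon>" "0 \<le> x1" "x1 \<le> t" "0 \<le> \<eta>" "0 < c" "0 \<le> m"
    and mean: "(\<integral>\<^sup>+\<omega>. ennreal (real (\<tau> \<omega>)) \<partial>M) = ennreal m"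
    and tails: "\<And>x. x1 \<le> x \<Longrightarrow> prob {\<omega> \<in> space M. x < c * real (\<tau> \<omega>)} \<le> \<eta> * tail F x"
    and K: "(\<integral>x. xexp \<epsilon> (trunc t x) \<partial>F) = K"
    and \<phi>: "(\<integral>x. exp (\<epsilon> * trunc t x) \<partial>F) \<le> exp (\<epsilon> * c)"
  shows "(\<integral>\<^sup>+\<omega>. ennreal (xexp \<epsilon> (trunc t (partial_sum \<xi> (\<tau> \<omega>) \<omega>))) \<partial>M)
    \<le> ennreal (K * (m * exp (\<epsilon> * x1) + \<eta> * K / c) + \<eta> * K)"
proof -
  let ?H = "xexp_increment \<epsilon> x1 t"
  have "0 \<le> t" using assms by simp
  note H = xexp_increment_bounds[OF assms(1-3)]
  note G = xexp_trunc_bounds[OF \<open>0 \<le> \<epsilon>\<close> \<open>0 \<le> t\<close>]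
  have int: "integrable F (\<lambda>x. xexp \<epsilon> (trunc t x))"
    using F.integrable_xexp_trunc[OF \<open>0 \<le> \<epsilon>\<close> \<open>0 \<le> t\<close>, of "\<lambda>x. x"] by simp
  have "0 \<le> K" unfolding K[symmetric] using G by (intro Bochner_Integration.integral_nonneg)
  define q where "q = K / c"
  have "0 \<le> q" using \<open>0 \<le> K\<close> \<open>0 < c\<close> by (simp add: q_def)
  define B where "B n = expectation (\<lambda>\<omega>. xexp \<epsilon> (trunc t (partial_sum \<xi> n \<omega>)))" for n
  \<comment> \<open>The first term handles \<open>c * n \<le> t\<close> through the bound for
    independent sums; the second is the trivial bound \<open>xexp \<epsilon> t\<close> for larger
    n.\<close>
  define D where "D n = K * (real n * exp (\<epsilon> * x1) + ?H (c * real n) / c)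
      + xexp \<epsilon> t * indicator {t<..} (c * real n)" for n
  have first_nonneg: "0 \<le> K * (real n * exp (\<epsilon> * x1) + ?H (c * real n) / c)" for n
    using \<open>0 \<le> K\<close> H \<open>0 < c\<close> by (intro mult_nonneg_nonneg add_nonneg_nonneg divide_nonneg_pos) auto
  have BD: "B n \<le> D n" for n
  proof (cases "c * real n \<le> t")
    case True
    have "B n \<le> K * (real (card {1..n}) * exp ((\<epsilon> * c) * real (card {1..n})))"
      unfolding B_def partial_sum_def
    proof (rule expectation_xexp_trunc_sum_le)
      show "indep_vars (\<lambda>_. borel) \<xi> {1..n}"
        using indep by (rule indep_vars_subset) auto
      show "expectation (\<lambda>\<omega>. xexp \<epsilon> (trunc t (\<xi> i \<omega>))) = K" if "i \<in> {1..n}" for i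
        using that expectation_\<xi>[of i "\<lambda>x. xexp \<epsilon> (trunc t x)"] K by simp
      show "expectation (\<lambda>\<omega>. exp (\<epsilon> * trunc t (\<xi> i \<omega>))) = (\<integral>x. exp (\<epsilon> * trunc t x) \<partial>F)"
        if "i \<in> {1..n}" for i
        using that expectation_\<xi>[of i "\<lambda>x. exp (\<epsilon> * trunc t x)"] by simp
    qed (use assms \<open>0 \<le> K\<close> \<open>0 \<le> t\<close> in auto)
    also have "\<dots> = K * (real n * exp (\<epsilon> * (c * real n)))" by (simp add: mult_ac)
    also have "\<dots> \<le> K * (real n * exp (\<epsilon> * x1) + ?H (c * real n) / c)"
    proof (intro mult_left_mono \<open>0 \<le> K\<close>)
      show "real n * exp (\<epsilon> * (c * real n)) \<le> real n * exp (\<epsilon> * x1) + ?H (c * real n) / c"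
      proof (cases "c * real n \<le> x1")
        case True
        then have "real n * exp (\<epsilon> * (c * real n)) \<le> real n * exp (\<epsilon> * x1)"
          using \<open>0 \<le> \<epsilon>\<close> by (intro mult_left_mono) (simp_all add: mult_left_mono)
        then show ?thesis using H(1)[of "c * real n"] \<open>0 < c\<close> by (simp add: add_increasing2)
      next
        case False
        then have "?H (c * real n) = c * real n * exp (\<epsilon> * (c * real n)) - x1 * exp (\<epsilon> * x1)"
          using True by (simp add: xexp_increment_def xexp_def)
        \<comment> \<open>Dividing the increment by \<open>c\<close> leaves the boundary term
          \<open>x1 / c\<close>, which is at most n because \<open>x1 < c * n\<close>.\<close>
        then have "real n * exp (\<epsilon> * (c * real n)) = x1 / c * exp (\<epsilon> * x1) + ?H (c * real n) / c"
          using \<open>0 < c\<close> by (simp add: field_simps)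
        also have "\<dots> \<le> real n * exp (\<epsilon> * x1) + ?H (c * real n) / c"
          using False \<open>0 < c\<close> by (intro add_right_mono mult_right_mono) (auto simp: field_simps)
        finally show ?thesis .
      qed
    qed
    also have "\<dots> = D n" using True by (simp add: D_def)
    finally show ?thesis .
  next
    case False
    have "B n \<le> expectation (\<lambda>_. xexp \<epsilon> t)"
      unfolding B_def using G \<open>0 \<le> t\<close> \<open>0 \<le> \<epsilon>\<close> by (intro integral_mono integrable_xexp_trunc) auto
    then have "B n \<le> xexp \<epsilon> t" by (simp add: prob_space)
    then show ?thesis using False first_nonneg[of n] by (simp add: D_def)
  qed
  have "(\<integral>\<^sup>+\<omega>. ennreal (xexp \<epsilon> (trunc t (partial_sum \<xi> (\<tau> \<omega>) \<omega>))) \<partial>M)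
    = (\<Sum>n. ennreal (prob {\<omega> \<in> space M. \<tau> \<omega> = n}) * ennreal (B n))"
  proof (subst nn_integral_random_sum[OF indep_\<tau> rv_\<xi>])
    have "(\<integral>\<^sup>+\<omega>. ennreal (xexp \<epsilon> (trunc t (partial_sum \<xi> n \<omega>))) \<partial>M) = ennreal (B n)" for n
      unfolding B_def using G \<open>0 \<le> t\<close> \<open>0 \<le> \<epsilon>\<close>
      by (intro nn_integral_eq_integral integrable_xexp_trunc) auto
    then show "(\<Sum>n. ennreal (prob {\<omega> \<in> space M. \<tau> \<omega> = n}) *
          (\<integral>\<^sup>+\<omega>. ennreal (xexp \<epsilon> (trunc t (partial_sum \<xi> n \<omega>))) \<partial>M))
        = (\<Sum>n. ennreal (prob {\<omega> \<in> space M. \<tau> \<omega> = n}) * ennreal (B n))"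
      by simp
  qed simp_all
  also have "\<dots> \<le> (\<Sum>n. ennreal (prob {\<omega> \<in> space M. \<tau> \<omega> = n}) * ennreal (D n))"
    by (intro suminf_le mult_left_mono ennreal_leI BD) simp_all
  also have "\<dots> = (\<integral>\<^sup>+\<omega>. ennreal (D (\<tau> \<omega>)) \<partial>M)"
    by (rule nn_integral_nat_valued_eq_suminf[OF measurable_\<tau>, symmetric])
  also have "\<dots> = (\<integral>\<^sup>+\<omega>. ennreal (K * exp (\<epsilon> * x1)) * ennreal (real (\<tau> \<omega>))
      + ennreal (K / c) * ennreal (?H (c * real (\<tau> \<omega>)))
      + ennreal (xexp \<epsilon> t) * indicator {\<omega> \<in> space M. t < c * real (\<tau> \<omega>)} \<omega> \<partial>M)"
  proof (intro nn_integral_cong)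
    fix \<omega> assume "\<omega> \<in> space M"
    have "ennreal (D (\<tau> \<omega>)) = ennreal (K * exp (\<epsilon> * x1) * real (\<tau> \<omega>) + K / c * ?H (c * real (\<tau> \<omega>))
      + xexp \<epsilon> t * indicator {t<..} (c * real (\<tau> \<omega>)))"
      by (simp add: D_def algebra_simps)
    also have "\<dots> = ennreal (K * exp (\<epsilon> * x1)) * ennreal (real (\<tau> \<omega>))
      + ennreal (K / c) * ennreal (?H (c * real (\<tau> \<omega>)))
      + ennreal (xexp \<epsilon> t * indicator {t<..} (c * real (\<tau> \<omega>)))"
      unfolding q_def[symmetric] using \<open>0 \<le> K\<close> \<open>0 \<le> q\<close> H \<open>0 \<le> t\<close>
      by (simp add: ennreal_plus ennreal_mult' xexp_nonneg)
    also have "ennreal (xexp \<epsilon> t * indicator {t<..} (c * real (\<tau> \<omega>)))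
      = ennreal (xexp \<epsilon> t) * indicator {\<omega> \<in> space M. t < c * real (\<tau> \<omega>)} \<omega>"
      using \<open>\<omega> \<in> space M\<close> by (simp add: indicator_def)
    finally show "ennreal (D (\<tau> \<omega>)) = ennreal (K * exp (\<epsilon> * x1)) * ennreal (real (\<tau> \<omega>))
      + ennreal (K / c) * ennreal (?H (c * real (\<tau> \<omega>)))
      + ennreal (xexp \<epsilon> t) * indicator {\<omega> \<in> space M. t < c * real (\<tau> \<omega>)} \<omega>" .
  qed
  also have "\<dots> = ennreal (K * exp (\<epsilon> * x1)) * ennreal m
      + ennreal (K / c) * (\<integral>\<^sup>+\<omega>. ennreal (?H (c * real (\<tau> \<omega>))) \<partial>M)
      + ennreal (xexp \<epsilon> t) * ennreal (prob {\<omega> \<in> space M. t < c * real (\<tau> \<omega>)})"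
    by (simp add: nn_integral_add nn_integral_cmult mean emeasure_eq_measure)
  also have "\<dots> \<le> ennreal (K * exp (\<epsilon> * x1)) * ennreal m
      + ennreal (K / c) * (ennreal \<eta> * ennreal K) + ennreal (\<eta> * K)"
  proof (intro add_mono mult_left_mono order_refl)
    let ?\<nu> = "distr M borel (\<lambda>\<omega>. c * real (\<tau> \<omega>))"
    interpret \<nu>: prob_space ?\<nu> by (rule prob_space_distr) simp
    have "(\<integral>\<^sup>+\<omega>. ennreal (?H (c * real (\<tau> \<omega>))) \<partial>M) = (\<integral>\<^sup>+x. ennreal (?H x) \<partial>?\<nu>)"
      by (subst nn_integral_distr) simp_all
    also have "\<dots> \<le> ennreal \<eta> * (\<integral>\<^sup>+x. ennreal (?H x) \<partial>F)"
    proof (rule nn_integral_xexp_increment_le)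
      fix s assume "x1 \<le> s"
      have "tail ?\<nu> s = prob {\<omega> \<in> space M. s < c * real (\<tau> \<omega>)}"
        unfolding tail_def by (subst measure_distr) (auto intro!: arg_cong[where f=prob])
      then show "tail ?\<nu> s \<le> \<eta> * tail F s" using tails[OF \<open>x1 \<le> s\<close>] by simp
    qed (use assms F.finite_measure_axioms \<nu>.finite_measure_axioms in auto)
    also have "(\<integral>\<^sup>+x. ennreal (?H x) \<partial>F) \<le> (\<integral>\<^sup>+x. ennreal (xexp \<epsilon> (trunc t x)) \<partial>F)"
      by (intro nn_integral_mono ennreal_leI H)
    also have "\<dots> = ennreal K"
      using int G K by (subst nn_integral_eq_integral) auto
    finally show "(\<integral>\<^sup>+\<omega>. ennreal (?H (c * real (\<tau> \<omega>))) \<partial>M) \<le> ennreal \<eta> * ennreal K"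
      by (simp add: mult_left_mono)
    \<comment> \<open>A Markov-type bound: above \<open>t\<close> the truncated variable equals
      \<open>t\<close>, so the tail at \<open>t\<close> times \<open>xexp \<epsilon> t\<close> is at
      most \<open>K\<close>.\<close>
    have "tail F t * xexp \<epsilon> t = (\<integral>x. indicator {t<..} x * xexp \<epsilon> t \<partial>F)"
      by (simp add: tail_def)
    also have "\<dots> \<le> (\<integral>x. xexp \<epsilon> (trunc t x) \<partial>F)"
    proof (rule integral_mono)
      show "integrable F (\<lambda>x. indicator {t<..} x * xexp \<epsilon> t)"
        by (simp add: integrable_real_indicator less_top[symmetric])
      show "indicator {t<..} x * xexp \<epsilon> t \<le> xexp \<epsilon> (trunc t x)" for x
      proof (cases "t < x")
        case True
        then have "trunc t x = t" using \<open>0 \<le> t\<close> by (simp add: trunc_def)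
        then show ?thesis using True by simp
      qed (simp add: G)
    qed (rule int)
    finally have "\<eta> * (tail F t * xexp \<epsilon> t) \<le> \<eta> * K"
      unfolding K using \<open>0 \<le> \<eta>\<close> by (rule mult_left_mono)
    moreover have "prob {\<omega> \<in> space M. t < c * real (\<tau> \<omega>)} * xexp \<epsilon> t \<le> \<eta> * tail F t * xexp \<epsilon> t"
      using tails[OF \<open>x1 \<le> t\<close>] xexp_nonneg[OF \<open>0 \<le> t\<close>] by (rule mult_right_mono)
    ultimately have "xexp \<epsilon> t * prob {\<omega> \<in> space M. t < c * real (\<tau> \<omega>)} \<le> \<eta> * K"
      by (simp add: mult_ac)
    then show "ennreal (xexp \<epsilon> t) * ennreal (prob {\<omega> \<in> space M. t < c * real (\<tau> \<omega>)}) \<le> ennreal (\<eta> * K)"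
      using \<open>0 \<le> t\<close> by (simp add: ennreal_mult'[symmetric] xexp_nonneg ennreal_leI)
  qed simp_all
  also have "\<dots> = ennreal (K * exp (\<epsilon> * x1) * m + K / c * (\<eta> * K) + \<eta> * K)"
    unfolding q_def[symmetric] using \<open>0 \<le> K\<close> \<open>0 \<le> q\<close> \<open>0 \<le> \<eta>\<close> \<open>0 \<le> m\<close>
    by (simp add: ennreal_plus ennreal_mult')
  also have "\<dots> = ennreal (K * (m * exp (\<epsilon> * x1) + \<eta> * K / c) + \<eta> * K)"
    by (simp add: algebra_simps)
  finally show ?thesis .
qed

lemma Liminf_tail_ratio_le:
  assumes heavy: "heavy_tailed F" and int: "integrable F (\<lambda>x. x)" and c: "(\<integral>x. x \<partial>F) < c"
    and pos: "\<And>x. 0 < tail F x"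
    and small: "(\<lambda>x. prob {\<omega> \<in> space M. c * real (\<tau> \<omega>) > x}) \<in> o[at_top](tail F)"
  shows "Liminf at_top (\<lambda>x. ennreal (tail (random_sum_distr M \<xi> \<tau>) x / tail F x))
    \<le> (\<integral>\<^sup>+\<omega>. ennreal (real (\<tau> \<omega>)) \<partial>M)"
proof (rule ccontr)
  define a where "a = (\<integral>x. x \<partial>F)"
  have "0 \<le> a" unfolding a_def using F_nonneg by (rule integral_nonneg_AE)
  then have "0 < c" using c by (simp add: a_def)
  assume "\<not> ?thesis"
  then have less: "(\<integral>\<^sup>+\<omega>. ennreal (real (\<tau> \<omega>)) \<partial>M)
      < Liminf at_top (\<lambda>x. ennreal (tail (random_sum_distr M \<xi> \<tau>) x / tail F x))"
    by simp
  \<comment> \<open>Strict inequalities on both sides make the mean and \<open>r'\<close> finite,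
    and leave a gap \<open>r - m > 0\<close>.\<close>
  then obtain r' where r': "(\<integral>\<^sup>+\<omega>. ennreal (real (\<tau> \<omega>)) \<partial>M) < r'"
      "r' < Liminf at_top (\<lambda>x. ennreal (tail (random_sum_distr M \<xi> \<tau>) x / tail F x))"
    using dense by blast
  obtain m where m: "0 \<le> m" "(\<integral>\<^sup>+\<omega>. ennreal (real (\<tau> \<omega>)) \<partial>M) = ennreal m"
    using r'(1) by (cases "\<integral>\<^sup>+\<omega>. ennreal (real (\<tau> \<omega>)) \<partial>M") auto
  obtain r where r: "0 \<le> r" "r' = ennreal r"
    using r'(2) by (cases r') auto
  have "m < r" using r'(1) m r by (simp add: ennreal_less_iff)
  have "0 < r" using m(1) \<open>m < r\<close> by simp
  have "\<forall>\<^sub>F x in at_top. r' < ennreal (tail (random_sum_distr M \<xi> \<tau>) x / tail F x)"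
    using r'(2) by (rule less_LiminfD)
  then have "\<forall>\<^sub>F x in at_top. r * tail F x \<le> tail (random_sum_distr M \<xi> \<tau>) x"
  proof eventually_elim
    case (elim x)
    then have "r < tail (random_sum_distr M \<xi> \<tau>) x / tail F x"
      using r by (simp add: ennreal_less_iff)
    then show ?case using pos[of x] by (simp add: field_simps)
  qed
  then have "\<forall>\<^sub>F x in at_top. 0 \<le> x \<and> r * tail F x \<le> tail (random_sum_distr M \<xi> \<tau>) x"
    using eventually_ge_at_top[of 0] by (rule eventually_elim2) simp
  then obtain x0 where x0: "0 \<le> x0" "\<And>x. x0 \<le> x \<Longrightarrow> r * tail F x \<le> tail (random_sum_distr M \<xi> \<tau>) x"
    unfolding eventually_at_top_linorder by blast
  \<comment> \<open>The first summand pushes \<open>K\<close> above the mean of \<open>F\<close>,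
    forcing large truncation levels. The second lets half of \<open>K * (r - m)\<close> absorb
    \<open>r * x0\<close>, the limit of the loss below \<open>x0\<close> as the exponent tends to
    0.\<close>
  define K where "K = 2 * a + 2 * r * x0 / (r - m) + 1"
  have K: "2 * a < K" "0 < K" "r * x0 < K * (r - m) / 2"
  proof -
    have "0 \<le> 2 * r * x0 / (r - m)" using \<open>0 < r\<close> x0(1) \<open>m < r\<close> by simp
    then show "2 * a < K" "0 < K" using \<open>0 \<le> a\<close> by (simp_all add: K_def)
    have "2 * r * x0 / (r - m) < K" using \<open>0 \<le> a\<close> by (simp add: K_def)
    then show "r * x0 < K * (r - m) / 2" using \<open>m < r\<close> by (simp add: field_simps)
  qed
  \<comment> \<open>The error caused by large values of \<open>\<tau>\<close> then totals
    \<open>K * (r - m) / 4\<close>.\<close>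
  define \<eta> where "\<eta> = (r - m) / 4 / (K / c + 1)"
  have Kc: "0 < K / c + 1" using K(2) \<open>0 < c\<close> by (simp add: add_pos_pos)
  have "0 < \<eta>" unfolding \<eta>_def using Kc \<open>m < r\<close> by (intro divide_pos_pos) simp_all
  moreover have "\<eta> * (K / c + 1) = (r - m) / 4"
    using Kc unfolding \<eta>_def by (metis less_irrefl nonzero_eq_divide_eq)
  ultimately have \<eta>: "0 < \<eta>" "\<eta> * (K / c + 1) = (r - m) / 4" .
  have "\<forall>\<^sub>F x in at_top. prob {\<omega> \<in> space M. x < c * real (\<tau> \<omega>)} \<le> \<eta> * tail F x"
    using landau_o.smallD[OF small \<eta>(1)] pos by (simp add: less_imp_le)
  then have "\<forall>\<^sub>F x in at_top. 0 \<le> x \<and> prob {\<omega> \<in> space M. x < c * real (\<tau> \<omega>)} \<le> \<eta> * tail F x"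
    using eventually_ge_at_top[of 0] by (rule eventually_elim2) simp
  then obtain x1 where x1: "0 \<le> x1"
      "\<And>x. x1 \<le> x \<Longrightarrow> prob {\<omega> \<in> space M. x < c * real (\<tau> \<omega>)} \<le> \<eta> * tail F x"
    unfolding eventually_at_top_linorder by blast
  define e where "e k = inverse (real (Suc k))" for k
  have e: "0 < e k" for k by (simp add: e_def)
  have e_lim: "e \<longlonglongrightarrow> 0"
    unfolding e_def by (rule LIMSEQ_inverse_real_of_nat)
  \<comment> \<open>Upper bound minus lower bound: in the limit the errors, a quarter and less than
    a half of \<open>K * (r - m)\<close>, do not make up for \<open>- K * (r - m)\<close>, so the
    bounds eventually contradict each other.\<close>
  have "(\<lambda>k. K * (m * exp (e k * x1) + \<eta> * K / c) + \<eta> * K - r * (K - xexp (e k) x0))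
      \<longlonglongrightarrow> K * (m * exp (0 * x1) + \<eta> * K / c) + \<eta> * K - r * (K - x0 * exp (0 * x0))"
    unfolding xexp_def by (intro tendsto_intros e_lim)
  moreover have "K * (m * exp (0 * x1) + \<eta> * K / c) + \<eta> * K - r * (K - x0 * exp (0 * x0))
      = K * (\<eta> * (K / c + 1)) - K * (r - m) + r * x0"
    by (simp add: algebra_simps)
  moreover have "\<dots> < 0"
  proof -
    have "0 < K * (r - m)" using K(2) \<open>m < r\<close> by simp
    then show ?thesis using K(3) unfolding \<eta>(2) by simp
  qed
  ultimately have "\<forall>\<^sub>F k in sequentially.
      K * (m * exp (e k * x1) + \<eta> * K / c) + \<eta> * K - r * (K - xexp (e k) x0) < 0"
    by (intro order_tendstoD(2)) auto
  moreover have "\<forall>\<^sub>F k in sequentially. a * exp (e k * max x0 x1) < K"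
  proof (rule order_tendstoD(2))
    show "(\<lambda>k. a * exp (e k * max x0 x1)) \<longlonglongrightarrow> a * exp (0 * max x0 x1)"
      by (intro tendsto_intros e_lim)
    show "a * exp (0 * max x0 x1) < K" using K \<open>0 \<le> a\<close> by simp
  qed
  moreover have "\<forall>\<^sub>F k in sequentially. \<forall>t\<ge>0.
    (\<integral>x. xexp (e k) (trunc t x) \<partial>F) \<le> K \<longrightarrow> (\<integral>x. exp (e k * trunc t x) \<partial>F) \<le> exp (e k * c)"
    unfolding e_def using F_nonneg int c K(2) by (rule F.eventually_exp_moment_le)
  ultimately have "\<forall>\<^sub>F k in sequentially. False"
  proof eventually_elim
    case (elim k)
    have ek: "0 \<le> e k" using e[of k] by simp
    obtain t where t: "0 \<le> t" "(\<integral>x. xexp (e k) (trunc t x) \<partial>F) = K"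
      using F.exists_truncation_level[OF heavy e[of k], of K] K(2) by auto
    have "max x0 x1 \<le> t"
    proof (rule ccontr)
      \<comment> \<open>A level below \<open>max x0 x1\<close> would bound the exponent uniformly,
        giving a truncated moment of at most \<open>a * exp (e k * max x0 x1)\<close>, which is less
        than \<open>K\<close>.\<close>
      assume "\<not> max x0 x1 \<le> t"
      have "K \<le> (\<integral>x. x * exp (e k * max x0 x1) \<partial>F)"
        unfolding t(2)[symmetric]
      proof (rule integral_mono_AE)
        show "integrable F (\<lambda>x. xexp (e k) (trunc t x))"
          using F.integrable_xexp_trunc[OF ek t(1), of "\<lambda>x. x"] by simp
        show "AE x in F. xexp (e k) (trunc t x) \<le> x * exp (e k * max x0 x1)"
          using F_nonneg
        proof eventually_elim
          case (elim x)
          have "trunc t x \<le> x" "trunc t x \<le> max x0 x1"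
            using elim \<open>\<not> max x0 x1 \<le> t\<close> t(1) by (auto simp: trunc_def)
          then show ?case
            unfolding xexp_def using elim ek
            by (intro mult_mono) (auto intro!: mult_left_mono)
        qed
      qed (use int in simp)
      also have "\<dots> = a * exp (e k * max x0 x1)" using int by (simp add: a_def)
      finally show False using elim(2) by simp
    qed
    then have "x0 \<le> t" "x1 \<le> t" by auto
    have "ennreal (r * (K - xexp (e k) x0))
        \<le> ennreal (K * (m * exp (e k * x1) + \<eta> * K / c) + \<eta> * K)"
    proof (rule order_trans)
      show "ennreal (r * (K - xexp (e k) x0))
          \<le> (\<integral>\<^sup>+\<omega>. ennreal (xexp (e k) (trunc t (partial_sum \<xi> (\<tau> \<omega>) \<omega>))) \<partial>M)"
        using ek x0(1) \<open>x0 \<le> t\<close> \<open>0 < r\<close> x0(2) t(2)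
        by (rule nn_integral_xexp_trunc_random_sum_ge)
      have "(\<integral>x. exp (e k * trunc t x) \<partial>F) \<le> exp (e k * c)" using elim(3) t by auto
      then show "(\<integral>\<^sup>+\<omega>. ennreal (xexp (e k) (trunc t (partial_sum \<xi> (\<tau> \<omega>) \<omega>))) \<partial>M)
          \<le> ennreal (K * (m * exp (e k * x1) + \<eta> * K / c) + \<eta> * K)"
        using ek x1 \<open>x1 \<le> t\<close> \<eta>(1) \<open>0 < c\<close> m t(2)
        by (intro nn_integral_xexp_trunc_random_sum_le) auto
    qed
    then have "r * (K - xexp (e k) x0) \<le> K * (m * exp (e k * x1) + \<eta> * K / c) + \<eta> * K"
      using K(2) m(1) \<eta>(1) \<open>0 < c\<close> by (subst (asm) ennreal_le_iff) auto
    then show False using elim(1) by simp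
  qed
  then show False by simp
qed

end

theorem theorem1:
  fixes M :: "'a measure" and F :: "real measure"
    and \<xi> :: "nat \<Rightarrow> 'a \<Rightarrow> real" and \<tau> :: "'a \<Rightarrow> nat" and c :: real
  assumes "prob_space M"
    and "prob_space.indep_vars M (\<lambda>_. borel) \<xi> {1..}"
    and "\<And>n. n \<ge> 1 \<Longrightarrow> distr M borel (\<xi> n) = F"
    and "\<And>n. n \<ge> 1 \<Longrightarrow> AE \<omega> in M. 0 \<le> \<xi> n \<omega>"
    and "indep_rvs M (count_space UNIV) \<tau>
           (\<Pi>\<^sub>M n\<in>{1..}. borel) (\<lambda>\<omega>. \<lambda>n\<in>{1..}. \<xi> n \<omega>)"
    and "\<And>x. tail F x > 0"
    and "heavy_tailed F"
    and "integrable F (\<lambda>x. x)"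
    and "c > (\<integral>x. x \<partial>F)"
    and "(\<lambda>x. measure M {\<omega> \<in> space M. c * real (\<tau> \<omega>) > x}) \<in> o[at_top](tail F)"
  shows "Liminf at_top (\<lambda>x. ennreal (tail (random_sum_distr M \<xi> \<tau>) x / tail F x))
           = (\<integral>\<^sup>+ \<omega>. ennreal (real (\<tau> \<omega>)) \<partial>M)"
proof -
  interpret prob_space M by fact
  interpret random_sum M F \<xi> \<tau>
    by unfold_locales (use assms in auto)
  show ?thesis
    using assms by (intro antisym Liminf_tail_ratio_le Liminf_tail_ratio_ge)
qed

end
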